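(* Let $g(s)=\frac{1}{1+G(s)}$ be the sensitivity function of a linear feedback system with open-loop (forward path) transfer function $G$. Suppose $g$ is non-analytic in the open right half plane, its zeros in the open right half plane are $\alpha_1,\dots,\alpha_M$, and its poles in the open right half plane are $\beta_1,\dots,\beta_N$. Let $\omega_c>0$ and suppose $$\rho=\max_{0\le\omega\le\omega_c}|g(j\omega)|\in[0,1),\qquad s_{\max}=\max_{\omega>\omega_c}|g(j\omega)|\in(1,\infty).$$ (a) Let $\sigma_k>0$ be a real point that is neither a zero nor a pole of $g$, and suppose $$-\log|g(\sigma_k)|+\sum_{1\le i\le M}\log\left|\frac{\sigma_k-\alpha_i}{\sigma_k+\overline{\alpha}_i}\right|+\sum_{1\le i\le N}\log\left|\frac{\sigma_k+\overline{\beta}_i}{\sigma_k-\beta_i}\right|<0.$$ Then $$\log s_{\max}\ \ge\ \frac{\left|\frac{\pi}{2}\left(-\log|g(\sigma_k)|+\sum_{1\le i\le M}\log\left|\frac{\sigma_k-\alpha_i}{\sigma_k+\overline{\alpha}_i}\right|+\sum_{1\le i\le N}\log\left|\frac{\sigma_k+\overline{\beta}_i}{\sigma_k-\beta_i}\right|\right)+\tan^{-1}\frac{\omega_c}{\sigma_k}\,\log\rho\right|}{\frac{\pi}{2}-\tan^{-1}\frac{\omega_c}{\sigma_k}}.$$ (b) Let $\sigma_k=\varsigma_k>0$ be a real zero of $G$ in the open right half plane, and suppose $$\sum_{1\le i\le M}\log\left|\frac{\sigma_k-\alpha_i}{\sigma_k+\overline{\alpha}_i}\right|+\sum_{1\le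 i\le N}\log\left|\frac{\sigma_k+\overline{\beta}_i}{\sigma_k-\beta_i}\right|<0.$$ Then $$\log s_{\max}\ \ge\ \frac{\left|\frac{\pi}{2}\left(\sum_{1\le i\le M}\log\left|\frac{\sigma_k-\alpha_i}{\sigma_k+\overline{\alpha}_i}\right|+\sum_{1\le i\le N}\log\left|\frac{\sigma_k+\overline{\beta}_i}{\sigma_k-\beta_i}\right|\right)+\tan^{-1}\frac{\omega_c}{\sigma_k}\,\log\rho\right|}{\frac{\pi}{2}-\tan^{-1}\frac{\omega_c}{\sigma_k}}.$$
   Context: Here $j$ is the imaginary unit, $\log$ of a positive real is the natural logarithm, and the open right half plane (RHP) is $\{s\in\mathbb{C}:\operatorname{Re}s>0\}$. The linear feedback system is a unity feedback loop with plant transfer function $G_p(s)$, controller transfer function $G_c(s)$ and open-loop (forward path) transfer function $G(s)=G_c(s)G_p(s)$. Transfer functions are quotients of polynomials with real coefficients, possibly multiplied by a dead-time factor: $G(s)=\frac{Q(s)}{P(s)}e^{-t_d s}$ with real polynomials $P,Q$, $P\not\equiv0$, and $t_d\ge 0$; no restriction is placed on the relative degree. It is assumed that $1+G\not\equiv 0$, and $g=1/(1+G)$ is regarded as a meromorphic function on $\mathbb{C}$. The lists $\alpha_1,\dots,\alpha_M$ and $\beta_1,\dots,\beta_N$ are finite and complete lists of the RHP zeros and RHP poles of $g$, repeated according to multiplicity. *)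

theory Defs
  imports "HOL-Complex_Analysis.Complex_Analysis"
begin

text \<open>
  Meromorphic functions are normalised with \<^const>\<open>remove_sings\<close>: removable singularities are
  filled in, so the totalised division by zero never determines a value, except that
  the value at a pole is the dummy \<open>0\<close>.  Hence zeros are tested with \<^const>\<open>isolated_zero\<close>
  (a limit condition, false at poles) and poles with \<^const>\<open>is_pole\<close>, never by evaluation.
\<close>

definition transfer_function :: "real poly \<Rightarrow> real poly \<Rightarrow> real \<Rightarrow> complex \<Rightarrow> complex" where
  "transfer_function Q P td =
     remove_sings (\<lambda>s. poly (map_poly of_real Q) s / poly (map_poly of_real P) s
                       * exp (- (of_real td * s)))"

definition is_transfer_function :: "(complex \<Rightarrow> complex) \<Rightarrow> bool" where
  "is_transfer_function G \<longleftrightarrow>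
     (\<exists>Q P td. P \<noteq> 0 \<and> td \<ge> 0 \<and> G = transfer_function Q P td)"

text \<open>At a pole of \<open>G\<close> the normalisation gives the sensitivity function its limit \<open>0\<close>.\<close>

definition sensitivity :: "(complex \<Rightarrow> complex) \<Rightarrow> complex \<Rightarrow> complex" where
  "sensitivity G = remove_sings (\<lambda>s. 1 / (1 + G s))"

definition open_RHP :: "complex set" where
  "open_RHP = {s. Re s > 0}"

text \<open>
  \<open>zs\<close> lists exactly the zeros (respectively poles) of \<open>f\<close> in \<open>S\<close>, each as often as its
  multiplicity.
\<close>

definition lists_zeros :: "(complex \<Rightarrow> complex) \<Rightarrow> complex set \<Rightarrow> complex list \<Rightarrow> bool" where
  "lists_zeros f S zs \<longleftrightarrow>
     (\<forall>z. count_list zs z = (if z \<in> S \<and> isolated_zero f z then nat (zorder f z) else 0))"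

definition lists_poles :: "(complex \<Rightarrow> complex) \<Rightarrow> complex set \<Rightarrow> complex list \<Rightarrow> bool" where
  "lists_poles f S zs \<longleftrightarrow>
     (\<forall>z. count_list zs z = (if z \<in> S \<and> is_pole f z then nat (- zorder f z) else 0))"

definition is_maximum :: "real set \<Rightarrow> real \<Rightarrow> bool" where
  "is_maximum A m \<longleftrightarrow> m \<in> A \<and> (\<forall>x\<in>A. x \<le> m)"

text \<open>
  Over the open, unbounded frequency range the peak need not be attained, so it is taken to be
  the supremum; boundedness says that it is finite.  As \<open>g\<close> is unbounded near a pole, a bound
  on \<open>|g|\<close> along an interval of the imaginary axis already excludes poles there, and the
  dummy value at poles does no harm.
\<close>

definition is_finite_supremum :: "real set \<Rightarrow> real \<Rightarrow> bool" where
  "is_finite_supremum A m \<longleftrightarrow> A \<noteq> {} \<and> bdd_above A \<and> m = Sup A"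

definition log_blaschke :: "complex list \<Rightarrow> complex list \<Rightarrow> real \<Rightarrow> real" where
  "log_blaschke \<alpha> \<beta> \<sigma> =
     (\<Sum>a\<leftarrow>\<alpha>. ln (cmod ((of_real \<sigma> - a) / (of_real \<sigma> + cnj a))))
   + (\<Sum>b\<leftarrow>\<beta>. ln (cmod ((of_real \<sigma> + cnj b) / (of_real \<sigma> - b))))"

end

theory Submission
  imports Defs
begin

text \<open>
  Dividing the zeros \<open>\<alpha>\<close> and the poles \<open>\<beta>\<close> out of \<open>g\<close> by Blaschke factors leaves a function \<open>f\<close>
  that is holomorphic on the closed right half plane and satisfies \<open>|f| = |g|\<close> on the imaginary
  axis.  If \<open>f\<close> is bounded, the two constants theorem estimates \<open>ln |f(\<sigma>)|\<close> by the mean of \<open>ln \<rho>\<close> and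
  \<open>ln s_max\<close> weighted with the harmonic measure \<open>(2 / pi) * arctan (\<omega>\<^sub>c / \<sigma>)\<close> of the segment
  \<open>[-\<i> \<omega>\<^sub>c, \<i> \<omega>\<^sub>c]\<close>, which is (a); at a zero of \<open>G\<close> one has \<open>g = 1\<close>, which gives (b).

  Boundedness near infinity comes from the finiteness of \<open>\<beta>\<close> and the boundedness of \<open>g\<close> on the axis.
  With a positive delay, a rational factor \<open>Q / P\<close> that has a pole at infinity or a limit of
  modulus above 1 would produce infinitely many poles of \<open>g\<close> in the half plane, and a limit of
  modulus 1 would make \<open>g\<close> unbounded on the axis.  In the remaining case \<open>|G|\<close> stays below some
  \<open>q < 1\<close> near infinity.
\<close>

section \<open>A two constants theorem for the right half plane\<close>

lemma Im_Ln_imaginary: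
  assumes "t \<noteq> 0"
  shows "Im (Ln (\<i> * of_real t)) = sgn t * (pi / 2)"
  using assms by (cases "t > 0") (auto simp: Ln_times_ii Ln_of_real sgn_if mult.commute Im_Ln_eq)

lemma norm_add_one_ge:
  assumes "Re s \<ge> 0"
  shows "cmod s \<le> cmod (s + 1)" and "1 \<le> cmod (s + 1)"
proof -
  show "cmod s \<le> cmod (s + 1)"
    using assms by (auto simp: cmod_def intro!: real_sqrt_le_mono power_mono)
  show "1 \<le> cmod (s + 1)"
    using assms complex_Re_le_cmod[of "s + 1"] by simp
qed

lemma norm_shift_le_norm_add_one:
  assumes "Re s \<ge> 0" "w \<ge> 0" "cmod c \<le> w"
  shows "cmod (s + c) \<le> (1 + w) * cmod (s + 1)"
proof -
  note norm_add_one_ge[OF assms(1)]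
  moreover from this have "w \<le> w * cmod (s + 1)"
    using assms(2) mult_left_mono[of 1 "cmod (s + 1)" w] by simp
  ultimately show ?thesis
    using norm_triangle_ineq[of s c] assms(3) by (simp add: algebra_simps)
qed

lemma not_nonpos_Reals_if_Re_nonneg: "Re z \<ge> 0 \<Longrightarrow> z \<noteq> 0 \<Longrightarrow> z \<notin> \<real>\<^sub>\<le>\<^sub>0"
  by (auto simp: complex_nonpos_Reals_iff complex_eq_iff)

text \<open>
  Harmonic measure is \<open>u s = (Arg (s + \<i> w) - Arg (s - \<i> w)) / pi\<close>.  The discontinuity of the boundary
  values at \<open>\<plusminus>\<i> w\<close> and the unbounded domain are handled by the damping factor \<open>D s powr \<epsilon>\<close>, where
  \<open>D\<close> vanishes at \<open>\<plusminus>\<i> w\<close> and at infinity and is bounded by \<open>(1 + w)\<^sup>2\<close>.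
\<close>
lemma half_plane_two_constants:
  fixes f :: "complex \<Rightarrow> complex"
  assumes hol: "f holomorphic_on {s. Re s > 0}"
    and cont: "continuous_on {s. Re s \<ge> 0} f"
    and bounded: "\<And>s. Re s \<ge> 0 \<Longrightarrow> cmod (f s) \<le> M"
    and w: "w > 0"
    and inner: "\<And>y. \<bar>y\<bar> < w \<Longrightarrow> cmod (f (\<i> * of_real y)) \<le> exp b1"
    and outer: "\<And>y. \<bar>y\<bar> > w \<Longrightarrow> cmod (f (\<i> * of_real y)) \<le> exp b2"
    and \<sigma>: "\<sigma> > 0"
  shows "cmod (f (of_real \<sigma>)) \<le> exp (b2 + (b1 - b2) * (2 / pi * arctan (w / \<sigma>)))"
proof -
  define p where "p = \<i> * of_real w"
  define T where "T = {s::complex. Re s \<ge> 0}"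
  define u where "u = (\<lambda>s. (Im (Ln (s + p)) - Im (Ln (s - p))) / pi)"
  \<comment> \<open>The numerator grows quadratically, so the cube makes \<open>D\<close> decay like
    \<open>1 / |s|\<close>. The shift by 1 keeps the zero of the denominator out of the closed half
    plane.\<close>
  define D where "D = (\<lambda>s. cmod (s + p) * cmod (s - p) / cmod (s + 1) ^ 3)"
  \<comment> \<open>The quotient of logarithms by \<open>pi * \<i>\<close> is an analytic function
    with real part \<open>u\<close>, so the first exponential has modulus
    \<open>exp (- (b2 + (b1 - b2) * u s))\<close>. The second one has modulus
    \<open>D s powr \<epsilon>\<close>.\<close>
  define H where "H = (\<lambda>\<epsilon> s. f s * exp (- (of_real b2 + of_real (b1 - b2) * ((Ln (s + p) - Ln (s - p)) / (of_real pi * \<i>))))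
      * exp (of_real \<epsilon> * (Ln (s + p) + Ln (s - p) - 3 * Ln (s + 1))))"
  \<comment> \<open>At \<open>p\<close> and \<open>- p\<close> one logarithm has argument 0. The
    value 0 is the continuous extension there, because \<open>D\<close> vanishes at these points and
    the other factors are bounded.\<close>
  define E where "E = (\<lambda>\<epsilon> s. if s = p \<or> s = - p then 0 else H \<epsilon> s)"
  define M' where "M' = M * exp (\<bar>b2\<bar> + \<bar>b1 - b2\<bar>)"
  have Rep [simp]: "Re p = 0" and cp: "cmod p = w" using w by (auto simp: p_def norm_mult)
  have M: "M \<ge> 0" using order_trans[OF norm_ge_zero bounded[of 0]] by simp
  have nz: "s + p \<noteq> 0" "s - p \<noteq> 0" if "\<not> (s = p \<or> s = - p)" for s
    using that by (auto simp: add_eq_0_iff)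
  have nz1: "s + 1 \<noteq> 0" if "Re s \<ge> 0" for s
    using that by (auto simp: complex_eq_iff)
  have normH: "cmod (H \<epsilon> s) = cmod (f s) * exp (- (b2 + (b1 - b2) * u s)) * D s powr \<epsilon>"
    if "Re s \<ge> 0" "\<not> (s = p \<or> s = - p)" for \<epsilon> s
  proof -
    have "cmod (exp (of_real \<epsilon> * (Ln (s + p) + Ln (s - p) - 3 * Ln (s + 1))))
        = exp (\<epsilon> * (ln (cmod (s + p)) + ln (cmod (s - p)) - 3 * ln (cmod (s + 1))))"
      using nz[OF that(2)] nz1[OF that(1)] by (simp add: norm_exp_eq_Re)
    also have "\<dots> = D s powr \<epsilon>"
      using nz[OF that(2)] nz1[OF that(1)]
      by (simp add: D_def powr_def ln_mult ln_div ln_realpow)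
    finally have 1: "cmod (exp (of_real \<epsilon> * (Ln (s + p) + Ln (s - p) - 3 * Ln (s + 1)))) = D s powr \<epsilon>" .
    have "Re ((Ln (s + p) - Ln (s - p)) / (of_real pi * \<i>)) = u s"
      by (simp add: u_def Re_divide power2_eq_square)
    moreover have Re_eq: "Re (of_real b2 + of_real (b1 - b2) * z) = b2 + (b1 - b2) * Re z" for z
      by simp
    ultimately have 2: "cmod (exp (- (of_real b2 + of_real (b1 - b2) * ((Ln (s + p) - Ln (s - p)) / (of_real pi * \<i>)))))
       = exp (- (b2 + (b1 - b2) * u s))"
      using Re_eq[of "(Ln (s + p) - Ln (s - p)) / (of_real pi * \<i>)"]
      by (simp only: norm_exp_eq_Re uminus_complex.sel)
    show ?thesis unfolding H_def norm_mult 1 2 ..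
  qed
  have u_le: "\<bar>u s\<bar> \<le> 1" if "Re s \<ge> 0" "\<not> (s = p \<or> s = - p)" for s
  proof -
    have "\<bar>Im (Ln (s + p))\<bar> \<le> pi / 2" "\<bar>Im (Ln (s - p))\<bar> \<le> pi / 2"
      using Re_Ln_pos_le[of "s + p"] Re_Ln_pos_le[of "s - p"] nz[OF that(2)] that(1) by auto
    thus ?thesis by (auto simp: u_def abs_le_iff field_simps)
  qed
  have D0: "D s \<ge> 0" for s by (simp add: D_def)
  have D_le: "D s \<le> (1 + w)\<^sup>2 / cmod (s + 1)" if "Re s \<ge> 0" for s
  proof -
    have pos: "cmod (s + 1) > 0" using nz1[OF that] by simp
    have "cmod (s + p) * cmod (s - p) \<le> ((1 + w) * cmod (s + 1)) * ((1 + w) * cmod (s + 1))"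
      using norm_shift_le_norm_add_one[of s w p] norm_shift_le_norm_add_one[of s w "-p"] that w cp
      by (intro mult_mono) auto
    hence "D s \<le> ((1 + w) * cmod (s + 1)) * ((1 + w) * cmod (s + 1)) / cmod (s + 1) ^ 3"
      unfolding D_def by (intro divide_right_mono) auto
    also have "\<dots> = (1 + w)\<^sup>2 / cmod (s + 1)"
      using pos by (simp add: divide_simps power2_eq_square power3_eq_cube)
    finally show ?thesis .
  qed
  have normE: "cmod (E \<epsilon> s) \<le> M' * D s powr \<epsilon>" if "Re s \<ge> 0" for \<epsilon> s
  proof (cases "s = p \<or> s = - p")
    case True thus ?thesis using M by (auto simp: E_def M'_def)
  next
    case False
    have "\<bar>(b1 - b2) * u s\<bar> \<le> \<bar>b1 - b2\<bar>"
      using u_le[OF that False] mult_left_mono[of "\<bar>u s\<bar>" 1 "\<bar>b1-b2\<bar>"] by (simp add: abs_mult)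
    hence "- (b2 + (b1 - b2) * u s) \<le> \<bar>b2\<bar> + \<bar>b1 - b2\<bar>" by linarith
    hence "cmod (f s) * exp (- (b2 + (b1 - b2) * u s)) \<le> M'"
      unfolding M'_def using M bounded[OF that] by (intro mult_mono) auto
    thus ?thesis using False normH[OF that False] by (simp add: E_def mult_right_mono)
  qed
  \<comment> \<open>This bound no longer contains \<open>M\<close>, so \<open>\<epsilon>\<close> can
    tend to 0 afterwards.\<close>
  have key: "cmod (E \<epsilon> (of_real \<sigma>)) \<le> ((1 + w)\<^sup>2) powr \<epsilon>" if \<epsilon>: "\<epsilon> > 0" for \<epsilon>
  proof -
    \<comment> \<open>On the arc \<open>|s| = R\<close> the damping factor contributes
      \<open>R powr - \<epsilon>\<close>, which absorbs \<open>M'\<close> once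
      \<open>R \<ge> M' powr (1 / \<epsilon>)\<close>. The entry \<open>\<sigma> + 1\<close> puts
      \<open>\<sigma>\<close> inside the half disc.\<close>
    define R where "R = max (\<sigma> + 1) (max 1 (M' powr (1 / \<epsilon>)))"
    define S where "S = {s::complex. Re s > 0} \<inter> ball 0 R"
    have R: "R > \<sigma>" "R \<ge> 1" "R \<ge> M' powr (1 / \<epsilon>)" by (auto simp: R_def)
    have openT: "open S" unfolding S_def by (intro open_Int open_halfspace_Re_gt open_ball)
    have clS: "closure S \<subseteq> T \<inter> cball 0 R"
      unfolding S_def T_def using closed_halfspace_Re_ge
      by (intro closure_minimal closed_Int) auto
    have contE: "continuous_on T (E \<epsilon>)"
      unfolding continuous_on_eq_continuous_within
    proof
      fix x assume x: "x \<in> T"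
      show "continuous (at x within T) (E \<epsilon>)"
      proof (cases "x = p \<or> x = - p")
        case True
        have "isCont D x" using nz1[of x] x unfolding D_def T_def
          by (intro continuous_intros) auto
        moreover have "D x = 0" using True by (auto simp: D_def)
        ultimately have "(D \<longlongrightarrow> 0) (at x within T)"
          by (metis continuous_at_imp_continuous_at_within continuous_within)
        hence "((\<lambda>s. M' * D s powr \<epsilon>) \<longlongrightarrow> M' * 0 powr \<epsilon>) (at x within T)"
          using \<epsilon> D0 by (intro tendsto_mult tendsto_const tendsto_powr') auto
        hence "((\<lambda>s. M' * D s powr \<epsilon>) \<longlongrightarrow> 0) (at x within T)"
          by simp
        moreover have "eventually (\<lambda>s. cmod (E \<epsilon> s) \<le> M' * D s powr \<epsilon>) (at x within T)"
          unfolding eventually_at_filter T_def by (intro always_eventually allI impI normE) simp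
        ultimately have "(E \<epsilon> \<longlongrightarrow> 0) (at x within T)"
          by (rule Lim_null_comparison[rotated])
        thus ?thesis using True by (auto simp: continuous_within E_def)
      next
        case False
        have nonneg: "x + p \<notin> \<real>\<^sub>\<le>\<^sub>0" "x - p \<notin> \<real>\<^sub>\<le>\<^sub>0" "x + 1 \<notin> \<real>\<^sub>\<le>\<^sub>0"
          using nz[OF False] nz1[of x] x by (intro not_nonpos_Reals_if_Re_nonneg; auto simp: T_def)+
        have "continuous (at x within T) f"
          using cont x unfolding T_def continuous_on_eq_continuous_within by blast
        moreover have "isCont (\<lambda>s. exp (- (of_real b2 + of_real (b1 - b2) * ((Ln (s + p) - Ln (s - p)) / (of_real pi * \<i>))))
            * exp (of_real \<epsilon> * (Ln (s + p) + Ln (s - p) - 3 * Ln (s + 1)))) x"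
          using nonneg by (intro continuous_intros) auto
        ultimately have "continuous (at x within T) (H \<epsilon>)"
          unfolding H_def mult.assoc
          by (rule continuous_mult[OF _ continuous_at_imp_continuous_at_within])
        moreover have "eventually (\<lambda>s. H \<epsilon> s = E \<epsilon> s) (at x within T)"
        proof -
          have "open (- {p, - p})" by (intro open_Compl finite_imp_closed) auto
          hence "eventually (\<lambda>s. s \<in> - {p, - p}) (nhds x)"
            using False by (intro eventually_nhds_in_open) auto
          thus ?thesis unfolding eventually_at_filter by eventually_elim (auto simp: E_def)
        qed
        ultimately show ?thesis using False
          by (auto simp: continuous_within E_def intro: Lim_transform_eventually)
      qed
    qed
    have holE: "E \<epsilon> holomorphic_on S"
    proof -
      have "H \<epsilon> holomorphic_on S"
        unfolding H_def
        by (intro holomorphic_intros holomorphic_on_subset[OF hol])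
           (auto simp: S_def complex_nonpos_Reals_iff)
      moreover have "E \<epsilon> holomorphic_on S \<longleftrightarrow> H \<epsilon> holomorphic_on S"
        by (intro holomorphic_cong) (auto simp: E_def S_def)
      ultimately show ?thesis by simp
    qed
    have frontier_le: "cmod (E \<epsilon> s) \<le> ((1 + w)\<^sup>2) powr \<epsilon>" if s: "s \<in> frontier S" for s
    proof -
      have s1: "s \<in> closure S" "s \<notin> S" using s openT by (auto simp: frontier_def interior_open)
      hence Re0: "Re s \<ge> 0" and sR: "cmod s \<le> R" using clS by (auto simp: T_def)
      have n1: "cmod (s + 1) \<ge> 1" "cmod (s + 1) \<ge> cmod s"
        using norm_add_one_ge[OF Re0] by auto
      have "(1 + w)\<^sup>2 / cmod (s + 1) \<le> (1 + w)\<^sup>2 / 1"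
        using n1 w by (intro divide_left_mono) auto
      hence D1: "D s \<le> (1 + w)\<^sup>2" using D_le[OF Re0] by simp
      have Dp: "D s powr \<epsilon> \<le> ((1 + w)\<^sup>2) powr \<epsilon>"
        using D1 D0 \<epsilon> by (intro powr_mono2) auto
      show ?thesis
      proof (cases "s = p \<or> s = - p")
        case True thus ?thesis by (auto simp: E_def)
      next
        case False
        show ?thesis
        proof (cases "Re s = 0")
          case True
          define y where "y = Im s"
          have sy: "s = \<i> * of_real y" using True by (auto simp: complex_eq_iff y_def)
          have yw: "y \<noteq> w" "y \<noteq> - w" using False by (auto simp: sy p_def)
          have "s + p = \<i> * of_real (y + w)" "s - p = \<i> * of_real (y - w)"
            by (simp_all add: sy p_def algebra_simps)
          hence us: "u s = (sgn (y + w) - sgn (y - w)) / 2"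
            using yw by (simp only: u_def Im_Ln_imaginary) (auto simp: Im_Ln_imaginary field_simps add_eq_0_iff2)
          \<comment> \<open>On the axis \<open>u\<close> equals 1 on the inner segment and 0 outside
            it, so the exponential cancels exactly \<open>exp b1\<close> or
            \<open>exp b2\<close>.\<close>
          have "cmod (f s) * exp (- (b2 + (b1 - b2) * u s)) \<le> 1"
          proof (cases "\<bar>y\<bar> < w")
            case True
            hence "u s = 1" by (auto simp: us sgn_if)
            thus ?thesis using inner[OF True] by (simp add: sy exp_minus field_simps exp_diff exp_add)
          next
            case False
            hence "u s = 0" "\<bar>y\<bar> > w" using yw w by (auto simp: us sgn_if)
            thus ?thesis using outer[of y] by (simp add: sy exp_minus field_simps)
          qed
          hence "cmod (f s) * exp (- (b2 + (b1 - b2) * u s)) * D s powr \<epsilon> \<le> 1 * D s powr \<epsilon>"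
            by (intro mult_right_mono) auto
          thus ?thesis using Dp False normH[OF Re0 False, of \<epsilon>] by (simp add: E_def)
        next
          case Re: False
          hence sR': "cmod s = R" using s1(2) Re0 sR by (auto simp: S_def)
          have "D s \<le> (1 + w)\<^sup>2 / R"
          proof (rule order_trans[OF D_le[OF Re0]], intro divide_left_mono mult_pos_pos)
            show "0 < R" "0 < cmod (s + 1)" using R n1 by linarith+
          qed (use n1 sR' in auto)
          hence "D s powr \<epsilon> \<le> ((1 + w)\<^sup>2 / R) powr \<epsilon>"
            using D0 \<epsilon> by (intro powr_mono2) auto
          also have "\<dots> = ((1 + w)\<^sup>2) powr \<epsilon> / R powr \<epsilon>"
            using R by (simp add: powr_divide)
          finally have a: "D s powr \<epsilon> \<le> ((1 + w)\<^sup>2) powr \<epsilon> / R powr \<epsilon>" .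
          have M'0: "M' \<ge> 0" using M by (simp add: M'_def)
          have "M' = (M' powr (1 / \<epsilon>)) powr \<epsilon>" using M'0 \<epsilon> by (simp add: powr_powr)
          also have "\<dots> \<le> R powr \<epsilon>" using R \<epsilon> by (intro powr_mono2) auto
          finally have b: "M' \<le> R powr \<epsilon>" .
          have "M' * D s powr \<epsilon> \<le> R powr \<epsilon> * (((1 + w)\<^sup>2) powr \<epsilon> / R powr \<epsilon>)"
            using a b M'0 by (intro mult_mono) auto
          also have "\<dots> = ((1 + w)\<^sup>2) powr \<epsilon>" using R by simp
          finally show ?thesis using normE[OF Re0, of \<epsilon>] by linarith
        qed
      qed
    qed
    show ?thesis
    proof (rule maximum_modulus_frontier[where f = "E \<epsilon>" and S = S])
      show "E \<epsilon> holomorphic_on interior S" using holE openT by (simp add: interior_open)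
      show "continuous_on (closure S) (E \<epsilon>)" using clS by (intro continuous_on_subset[OF contE]) auto
      show "bounded S" unfolding S_def by (rule bounded_subset[OF bounded_ball]) auto
      show "of_real \<sigma> \<in> S" using R(1) \<sigma> by (simp add: S_def)
    qed (rule frontier_le)
  qed
  define c where "c = cmod (f (of_real \<sigma>)) * exp (- (b2 + (b1 - b2) * u (of_real \<sigma>)))"
  have np: "\<not> (of_real \<sigma> = p \<or> of_real \<sigma> = - p)"
    using \<sigma> w by (auto simp: p_def complex_eq_iff)
  have Dpos: "D (of_real \<sigma>) > 0" using nz[OF np] nz1[of "of_real \<sigma>"] \<sigma> by (simp add: D_def)
  have le: "c * D (of_real \<sigma>) powr \<epsilon> \<le> ((1 + w)\<^sup>2) powr \<epsilon>" if "\<epsilon> > 0" for \<epsilon>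
    using key[OF that] normH[of "of_real \<sigma>" \<epsilon>] np \<sigma> by (simp add: E_def c_def)
  \<comment> \<open>As \<open>\<epsilon>\<close> decreases to 0 both damping powers tend to 1, since
    their bases are positive. What remains is \<open>c \<le> 1\<close>.\<close>
  have "((\<lambda>\<epsilon>. c * D (of_real \<sigma>) powr \<epsilon>) \<longlongrightarrow> c * D (of_real \<sigma>) powr 0) (at_right 0)"
    using Dpos by (intro tendsto_intros) auto
  moreover have "((\<lambda>\<epsilon>. ((1 + w)\<^sup>2) powr \<epsilon>) \<longlongrightarrow> ((1 + w)\<^sup>2) powr 0) (at_right 0)"
    using w by (intro tendsto_intros) auto
  ultimately have "c * D (of_real \<sigma>) powr 0 \<le> ((1 + w)\<^sup>2) powr 0"
    using le by (intro tendsto_le[OF trivial_limit_at_right_real])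
      (auto simp: eventually_at_filter)
  hence c1: "c \<le> 1" using Dpos w by simp
  have u\<sigma>: "u (of_real \<sigma>) = 2 / pi * arctan (w / \<sigma>)"
  proof -
    have "Im (Ln (of_real \<sigma> + p)) = arctan (w / \<sigma>)" "Im (Ln (of_real \<sigma> - p)) = - arctan (w / \<sigma>)"
      using \<sigma> nz[OF np] arg_conv_arctan[of "of_real \<sigma> + p"] arg_conv_arctan[of "of_real \<sigma> - p"]
      by (simp_all add: Arg_eq_Im_Ln p_def arctan_minus)
    thus ?thesis by (simp add: u_def)
  qed
  show ?thesis using c1 unfolding c_def u\<sigma> exp_minus divide_inverse[symmetric] by simp
qed

section \<open>Rational functions with a delay near infinity\<close>

text \<open>For \<open>s \<noteq> 0\<close> the quotient is the reflected polynomial at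
  \<open>inverse s\<close>, and the constant coefficient of that polynomial is the leading
  coefficient of \<open>p\<close>.\<close>

lemma poly_div_power_tendsto_lead_coeff:
  fixes p :: "complex poly"
  shows "((\<lambda>s. poly p s / s ^ degree p) \<longlongrightarrow> lead_coeff p) at_infinity"
proof -
  have "((\<lambda>s. poly (reflect_poly p) (inverse s)) \<longlongrightarrow> poly (reflect_poly p) 0) at_infinity"
    by (intro tendsto_intros tendsto_inverse_0)
  moreover have "eventually (\<lambda>s::complex. s \<noteq> 0) at_infinity"
    by (rule eventually_not_equal_at_infinity)
  hence "eventually (\<lambda>s. poly (reflect_poly p) (inverse s) = poly p s / s ^ degree p) at_infinity"
    by eventually_elim (simp add: poly_reflect_poly_nz divide_inverse power_inverse mult.commute)
  ultimately show ?thesis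
    by (simp add: poly_0_coeff_0 Lim_transform_eventually)
qed

lemma eventually_poly_nonzero_at_infinity:
  fixes p :: "complex poly"
  assumes "p \<noteq> 0"
  shows "eventually (\<lambda>s. poly p s \<noteq> 0) at_infinity"
proof -
  have "bounded {s. poly p s = 0}" using poly_roots_finite[OF assms] by (rule finite_imp_bounded)
  then obtain K where "\<And>s. poly p s = 0 \<Longrightarrow> cmod s \<le> K" by (auto simp: bounded_iff)
  thus ?thesis unfolding eventually_at_infinity by (intro exI[of _ "K + 1"]) fastforce
qed

lemma poly_quotient_tendsto:
  fixes p q :: "complex poly"
  assumes "p \<noteq> 0" "degree p \<le> degree q"
  shows "((\<lambda>s. poly q s / poly p s / s ^ (degree q - degree p)) \<longlongrightarrow> lead_coeff q / lead_coeff p) at_infinity"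
proof -
  have "((\<lambda>s. (poly q s / s ^ degree q) / (poly p s / s ^ degree p)) \<longlongrightarrow> lead_coeff q / lead_coeff p) at_infinity"
    using assms by (intro tendsto_divide poly_div_power_tendsto_lead_coeff) auto
  moreover have "eventually (\<lambda>s. (poly q s / s ^ degree q) / (poly p s / s ^ degree p)
      = poly q s / poly p s / s ^ (degree q - degree p)) at_infinity"
    using eventually_not_equal_at_infinity[of "0::complex"]
    by eventually_elim (use assms(2) in \<open>simp add: power_diff field_simps\<close>)
  ultimately show ?thesis by (rule Lim_transform_eventually)
qed

lemma poly_quotient_tendsto_0:
  fixes p q :: "complex poly"
  assumes "degree q < degree p"
  shows "((\<lambda>s. poly q s / poly p s) \<longlongrightarrow> 0) at_infinity"
proof -
  have "((\<lambda>s. (poly q s / s ^ degree q) / (poly p s / s ^ degree p) * inverse s ^ (degree p - degree q))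
      \<longlongrightarrow> lead_coeff q / lead_coeff p * 0 ^ (degree p - degree q)) at_infinity"
    using assms by (intro tendsto_mult tendsto_divide tendsto_power tendsto_inverse_0 poly_div_power_tendsto_lead_coeff) auto
  moreover have "eventually (\<lambda>s. (poly q s / s ^ degree q) / (poly p s / s ^ degree p) * inverse s ^ (degree p - degree q)
      = poly q s / poly p s) at_infinity"
    using eventually_not_equal_at_infinity[of "0::complex"]
  proof eventually_elim
    case (elim s)
    have "s ^ degree p = s ^ degree q * s ^ (degree p - degree q)"
      using assms by (simp flip: power_add)
    thus ?case using elim by (simp add: power_inverse field_simps)
  qed
  ultimately show ?thesis using assms by (simp add: Lim_transform_eventually power_0_left)
qed

section \<open>Roots and near-roots of the delay equation\<close>

text \<open>
  Along the imaginary axis at height \<open>y\<close> with \<open>exp (\<i> * t * y) = 1\<close> the equation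
  \<open>R s * exp (- t * s) = -1\<close> reads \<open>s = s0 + Ln (R s / (c * (\<i> * y) ^ m)) / t\<close>, where the
  logarithm is small; Brouwer's theorem then provides a solution near \<open>s0\<close>.
\<close>
lemma delay_equation_zeros:
  fixes R :: "complex \<Rightarrow> complex"
  assumes lim: "((\<lambda>s. R s / s ^ m) \<longlongrightarrow> c) at_infinity" and c: "c \<noteq> 0" and t: "t > 0"
    and large: "m > 0 \<or> cmod c > 1"
    and cont: "\<And>s. cmod s \<ge> K \<Longrightarrow> isCont R s"
  shows "\<exists>s. Re s > 0 \<and> cmod s > K \<and> 1 + R s * exp (- (of_real t * s)) = 0"
proof -
  \<comment> \<open>An eventual positive lower bound for \<open>ln (cmod (A y))\<close>: this
    quantity is constantly \<open>ln (cmod c)\<close> if \<open>m = 0\<close> and tends to infinity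
    otherwise.\<close>
  define L where "L = (if m = 0 then ln (cmod c) else 1)"
  have L: "L > 0" using large by (auto simp: L_def intro: ln_gt_zero)
  \<comment> \<open>Half of \<open>L / t\<close>, the eventual lower bound for
    \<open>Re (s0 y)\<close>; hence the ball of radius \<open>\<delta>\<close> about
    \<open>s0 y\<close> stays in the open right half plane.\<close>
  define \<delta> where "\<delta> = L / (2 * t)"
  have \<delta>: "\<delta> > 0" using L t by (simp add: \<delta>_def)
  \<comment> \<open>The equation amounts to \<open>exp (t * s) = - R s\<close>, and
    \<open>A y\<close> is the leading term of the right-hand side for \<open>s\<close> near
    \<open>\<i> * y\<close>. The error is the factor \<open>V y s\<close>, since
    \<open>- R s = A y * V y s\<close>.\<close>
  define A where "A = (\<lambda>y::real. - c * (\<i> * of_real y) ^ m)"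
  define s0 where "s0 = (\<lambda>y. Ln (A y) / of_real t + \<i> * of_real y)"
  \<comment> \<open>Chosen for the estimate \<open>|Ln (1 + z)| \<le> 2 * |z|\<close>, valid for
    \<open>|z| < 1 / 2\<close>: it makes \<open>|Ln (V y s)| \<le> t * \<delta>\<close>, so the
    iteration map sends the ball to itself.\<close>
  define \<eta> where "\<eta> = min (1 / 2) (t * \<delta> / 2)"
  have \<eta>: "\<eta> > 0" using t \<delta> by (simp add: \<eta>_def)
  define V where "V = (\<lambda>y s. R s / (c * (\<i> * of_real y) ^ m))"
  define P where "P = (\<lambda>y s. cmod (V y s - 1) < \<eta> \<and> cmod s > K)"
  have normA: "cmod (A y) = cmod c * y ^ m" if "y > 0" for y
    using that by (simp add: A_def norm_mult norm_power)
  have A0: "A y \<noteq> 0" if "y > 0" for y using that c by (simp add: A_def)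
  have ev0: "eventually (\<lambda>y::real. y > 0) at_top" by (rule eventually_gt_at_top)
  have lnA: "ln (cmod (A y)) = ln (cmod c) + m * ln y" if "y > 0" for y
    using that c by (simp add: normA ln_mult ln_realpow)
  have evL: "eventually (\<lambda>y. ln (cmod (A y)) \<ge> L) at_top"
  proof (cases "m = 0")
    case True
    show ?thesis using ev0 by eventually_elim (simp add: lnA L_def True)
  next
    case False
    have "filterlim (\<lambda>y. ln (cmod c) + m * ln y) at_top at_top"
      using False by (intro filterlim_tendsto_add_at_top[OF tendsto_const]
        filterlim_tendsto_pos_mult_at_top[OF tendsto_const] ln_at_top) auto
    hence "eventually (\<lambda>y. ln (cmod c) + m * ln y \<ge> L) at_top"
      by (simp add: filterlim_at_top)
    thus ?thesis using ev0 by eventually_elim (simp add: lnA)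
  qed
  have small: "((\<lambda>y. ((\<bar>ln (cmod c)\<bar> + pi) / t + \<delta>) / y + m / t * (ln y / y)) \<longlongrightarrow> 0) at_top"
  proof -
    have "((\<lambda>y. ((\<bar>ln (cmod c)\<bar> + pi) / t + \<delta>) / y + m / t * (ln y / y)) \<longlongrightarrow> 0 + m / t * 0) at_top"
      by (intro tendsto_intros tendsto_divide_0[OF tendsto_const] ln_x_over_x_tendsto_0
          filterlim_at_top_imp_at_infinity filterlim_ident)
    thus ?thesis by simp
  qed
  \<comment> \<open>Since \<open>s0 y\<close> differs from \<open>\<i> * y\<close> only by
    \<open>Ln (A y) / t\<close>, which is of order at most \<open>ln y\<close>, every such
    \<open>X y\<close> is asymptotic to \<open>\<i> * y\<close>. Hence \<open>V y (X y)\<close>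
    tends to 1.\<close>
  have limX: "eventually (\<lambda>y. P y (X y)) at_top" if X: "\<And>y. cmod (X y - s0 y) \<le> \<delta>" for X
  proof -
    have "eventually (\<lambda>y. cmod (X y / (\<i> * of_real y) - 1)
        \<le> ((\<bar>ln (cmod c)\<bar> + pi) / t + \<delta>) / y + m / t * (ln y / y)) at_top"
      using eventually_gt_at_top[of 1]
    proof eventually_elim
      case (elim y)
      have "cmod (Ln (A y)) \<le> \<bar>Re (Ln (A y))\<bar> + \<bar>Im (Ln (A y))\<bar>" by (rule cmod_le)
      also have "\<bar>Im (Ln (A y))\<bar> \<le> pi"
        using A0[of y] elim mpi_less_Im_Ln[of "A y"] Im_Ln_le_pi[of "A y"] by auto
      also have "\<bar>Re (Ln (A y))\<bar> \<le> \<bar>ln (cmod c)\<bar> + m * ln y"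
        using A0[of y] elim lnA[of y] by (simp add: abs_le_iff) (smt (verit) ln_gt_zero mult_nonneg_nonneg of_nat_0_le_iff)
      finally have 1: "cmod (Ln (A y)) \<le> \<bar>ln (cmod c)\<bar> + m * ln y + pi" by simp
      have "X y / (\<i> * of_real y) - 1 = (Ln (A y) / of_real t + (X y - s0 y)) / (\<i> * of_real y)"
        using elim by (simp add: s0_def field_simps)
      hence "cmod (X y / (\<i> * of_real y) - 1) = cmod (Ln (A y) / of_real t + (X y - s0 y)) / y"
        using elim by (simp add: norm_divide norm_mult)
      also have "\<dots> \<le> (cmod (Ln (A y)) / t + \<delta>) / y"
        using elim X[of y] t norm_triangle_ineq[of "Ln (A y) / of_real t" "X y - s0 y"]
        by (intro divide_right_mono) (auto simp: norm_divide)
      also have "\<dots> \<le> ((\<bar>ln (cmod c)\<bar> + m * ln y + pi) / t + \<delta>) / y"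
        using 1 elim t by (intro divide_right_mono add_mono) auto
      also have "\<dots> = ((\<bar>ln (cmod c)\<bar> + pi) / t + \<delta>) / y + m / t * (ln y / y)"
        using elim t by (simp add: field_simps)
      finally show ?case .
    qed
    hence "((\<lambda>y. X y / (\<i> * of_real y) - 1) \<longlongrightarrow> 0) at_top"
      using small by (rule Lim_null_comparison)
    hence q1: "((\<lambda>y. X y / (\<i> * of_real y)) \<longlongrightarrow> 1) at_top"
      by (simp add: LIM_zero_iff)
    have "filterlim (\<lambda>y. \<i> * complex_of_real y) at_infinity at_top"
      by (intro tendsto_mult_filterlim_at_infinity[OF tendsto_const] filterlim_compose[OF filterlim_of_real_at_infinity]
           filterlim_at_top_imp_at_infinity filterlim_ident) auto
    with q1 have "filterlim (\<lambda>y. X y / (\<i> * of_real y) * (\<i> * of_real y)) at_infinity at_top"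
      by (intro tendsto_mult_filterlim_at_infinity[OF q1]) auto
    moreover have "eventually (\<lambda>y. X y / (\<i> * of_real y) * (\<i> * of_real y) = X y) at_top"
      using ev0 by eventually_elim simp
    ultimately have Xinf: "filterlim X at_infinity at_top"
      by (rule filterlim_cong[OF refl refl, THEN iffD1, rotated])
    have "((\<lambda>y. R (X y) / X y ^ m * (X y / (\<i> * of_real y)) ^ m / c) \<longlongrightarrow> c * 1 ^ m / c) at_top"
      using c by (intro tendsto_intros q1 filterlim_compose[OF lim Xinf])
    moreover have "eventually (\<lambda>y. X y \<noteq> 0) at_top"
      using filterlim_at_infinity_imp_eventually_ne[OF Xinf, of 0] .
    hence "eventually (\<lambda>y. R (X y) / X y ^ m * (X y / (\<i> * of_real y)) ^ m / c = V y (X y)) at_top"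
      using ev0 by eventually_elim (simp add: V_def power_divide field_simps)
    ultimately have "((\<lambda>y. V y (X y)) \<longlongrightarrow> c * 1 ^ m / c) at_top"
      by (rule Lim_transform_eventually)
    hence "((\<lambda>y. V y (X y)) \<longlongrightarrow> 1) at_top" using c by simp
    hence "eventually (\<lambda>y. cmod (V y (X y) - 1) < \<eta>) at_top"
      using \<eta> by (auto simp: tendsto_iff dist_norm)
    moreover have "eventually (\<lambda>y. cmod (X y) > K) at_top"
    proof -
      have "filterlim (\<lambda>y. cmod (X y)) at_top at_top" using Xinf by (rule filterlim_at_infinity_imp_norm_at_top)
      thus ?thesis by (simp add: filterlim_at_top_dense)
    qed
    ultimately show ?thesis unfolding P_def by eventually_elim simp
  qed
  \<comment> \<open>Uniformity over the ball: \<open>limX\<close> is applied to a function that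
    selects a violating point whenever there is one.\<close>
  have evP: "eventually (\<lambda>y. \<forall>s\<in>cball (s0 y) \<delta>. P y s) at_top"
  proof -
    define X where "X = (\<lambda>y. if \<exists>s\<in>cball (s0 y) \<delta>. \<not> P y s then SOME s. s \<in> cball (s0 y) \<delta> \<and> \<not> P y s else s0 y)"
    have X: "X y \<in> cball (s0 y) \<delta> \<and> ((\<exists>s\<in>cball (s0 y) \<delta>. \<not> P y s) \<longrightarrow> \<not> P y (X y))" for y
    proof (cases "\<exists>s\<in>cball (s0 y) \<delta>. \<not> P y s")
      case True
      hence "\<exists>s. s \<in> cball (s0 y) \<delta> \<and> \<not> P y s" by blast
      from someI_ex[OF this] show ?thesis using True by (simp add: X_def)
    next
      case False
      thus ?thesis using \<delta> by (auto simp: X_def)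
    qed
    have "eventually (\<lambda>y. P y (X y)) at_top"
      using X by (intro limX) (auto simp: dist_norm norm_minus_commute)
    thus ?thesis by eventually_elim (use X in blast)
  qed
  \<comment> \<open>The heights \<open>y = 2 * pi * k / t\<close> satisfy
    \<open>exp (\<i> * t * y) = 1\<close> and are unbounded, so one of them meets all the eventual
    conditions.\<close>
  have "filterlim (\<lambda>k::nat. 2 * pi / t * real k) at_top sequentially"
    using t by (intro filterlim_tendsto_pos_mult_at_top[OF tendsto_const] filterlim_real_sequentially) auto
  from eventually_compose_filterlim[OF eventually_conj[OF evP eventually_conj[OF evL ev0]] this]
  obtain k :: nat where k: "\<forall>s\<in>cball (s0 (2 * pi / t * k)) \<delta>. P (2 * pi / t * k) s"
      "ln (cmod (A (2 * pi / t * k))) \<ge> L" "2 * pi / t * k > 0"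
    using eventually_happens'[OF sequentially_bot] by blast
  define y where "y = 2 * pi / t * k"
  note k = k[folded y_def]
  have ball: "V y s \<noteq> 0" "V y s \<notin> \<real>\<^sub>\<le>\<^sub>0" "cmod (Ln (V y s)) \<le> t * \<delta>" "cmod s > K"
    if "s \<in> cball (s0 y) \<delta>" for s
  proof -
    have *: "cmod (V y s - 1) < \<eta>" "cmod s > K" using k(1) that by (auto simp: P_def)
    thus "cmod s > K" by simp
    have "\<bar>Re (V y s - 1)\<bar> \<le> cmod (V y s - 1)" by (rule abs_Re_le_cmod)
    moreover have "cmod (V y s - 1) < 1 / 2" using *(1) by (simp add: \<eta>_def)
    ultimately have "Re (V y s) > 0" by (simp add: abs_le_iff)
    thus "V y s \<noteq> 0" "V y s \<notin> \<real>\<^sub>\<le>\<^sub>0" by (auto simp: complex_nonpos_Reals_iff)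
    show "cmod (Ln (V y s)) \<le> t * \<delta>"
      using norm_Ln_le[of "V y s - 1"] *(1) by (simp add: \<eta>_def)
  qed
  have nz: "c * (\<i> * of_real y) ^ m \<noteq> 0" using c k(3) by simp
  obtain s where s: "s \<in> cball (s0 y) \<delta>" "s0 y + Ln (V y s) / of_real t = s"
  proof (rule brouwer_ball[OF \<delta>, of "s0 y" "\<lambda>s. s0 y + Ln (V y s) / of_real t"])
    have "isCont (V y) s" if "s \<in> cball (s0 y) \<delta>" for s
      unfolding V_def using cont[of s] ball(4)[OF that] nz by (intro continuous_intros) auto
    hence "continuous_on (cball (s0 y) \<delta>) (V y)"
      by (intro continuous_at_imp_continuous_on) auto
    thus "continuous_on (cball (s0 y) \<delta>) (\<lambda>s. s0 y + Ln (V y s) / of_real t)"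
      using t ball(2) by (intro continuous_intros) auto
    show "(\<lambda>s. s0 y + Ln (V y s) / of_real t) \<in> cball (s0 y) \<delta> \<rightarrow> cball (s0 y) \<delta>"
      using ball(3) t by (auto simp: dist_norm norm_divide field_simps)
  qed
  have "of_real t * s = Ln (A y) + \<i> * of_real (t * y) + Ln (V y s)"
    using t by (subst s(2)[symmetric]) (simp add: s0_def field_simps)
  also have "exp \<dots> = A y * exp (\<i> * of_real (t * y)) * V y s"
    using A0[OF k(3)] ball(1)[OF s(1)] by (simp add: exp_add)
  also have "exp (\<i> * of_real (t * y)) = 1"
    using t by (simp add: y_def exp_eq_1 exI[of _ "int k"])
  also have "A y * 1 * V y s = - R s" using nz by (simp add: A_def V_def)
  finally have "exp (of_real t * s) = - R s" .
  hence "1 + R s * exp (- (of_real t * s)) = 1 - exp (of_real t * s) * exp (- (of_real t * s))"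
    by simp
  also have "\<dots> = 0" by (simp flip: exp_add)
  finally have zero: "1 + R s * exp (- (of_real t * s)) = 0" .
  have "Re (s0 y) = ln (cmod (A y)) / t" using A0[OF k(3)] by (simp add: s0_def)
  hence "Re (s0 y) \<ge> L / t" using k(2) t by (simp add: divide_right_mono)
  moreover have "\<bar>Re (s - s0 y)\<bar> \<le> \<delta>"
    using s(1) abs_Re_le_cmod[of "s - s0 y"] by (simp add: dist_norm norm_minus_commute)
  moreover have "\<delta> < L / t" using L t by (simp add: \<delta>_def field_simps)
  ultimately have "Re s > 0" by simp
  with zero ball(4)[OF s(1)] show ?thesis by blast
qed

text \<open>As \<open>|c| = 1\<close>, there are arbitrarily large heights at which the exponential
  \<open>exp (t * \<i> * y)\<close> equals \<open>- c\<close>. Along them the product tends to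
  \<open>c / (- c) = - 1\<close>. This contradicts a bound on the sensitivity function along the
  axis.\<close>

lemma delay_equation_near_zeros:
  fixes R :: "complex \<Rightarrow> complex"
  assumes lim: "(R \<longlongrightarrow> c) at_infinity" and c: "cmod c = 1" and t: "t > 0" and e: "e > 0"
  shows "\<exists>y>K. cmod (1 + R (\<i> * of_real y) * exp (- (of_real t * (\<i> * of_real y)))) < e"
proof -
  define y where "y = (\<lambda>k::nat. (Arg (- c) + 2 * pi * real k) / t)"
  have ytop: "filterlim y at_top sequentially"
    unfolding y_def divide_inverse using t
    by (intro filterlim_at_top_mult_tendsto_pos[OF tendsto_const] filterlim_tendsto_add_at_top[OF tendsto_const]
        filterlim_tendsto_pos_mult_at_top[OF tendsto_const] filterlim_real_sequentially) auto
  have "filterlim (\<lambda>k. \<i> * complex_of_real (y k)) at_infinity sequentially"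
    by (intro tendsto_mult_filterlim_at_infinity[OF tendsto_const] filterlim_compose[OF filterlim_of_real_at_infinity]
           filterlim_at_top_imp_at_infinity[OF ytop]) (auto intro: ytop)
  hence "(\<lambda>k. R (\<i> * of_real (y k))) \<longlonglongrightarrow> c" by (rule filterlim_compose[OF lim])
  hence "(\<lambda>k. 1 + R (\<i> * of_real (y k)) * inverse (- c)) \<longlonglongrightarrow> 1 + c * inverse (- c)"
    by (intro tendsto_intros)
  moreover have c0: "c \<noteq> 0" using c by auto
  ultimately have "(\<lambda>k. 1 + R (\<i> * of_real (y k)) * inverse (- c)) \<longlonglongrightarrow> 0" by simp
  hence "eventually (\<lambda>k. cmod (1 + R (\<i> * of_real (y k)) * inverse (- c)) < e) sequentially"
    using e by (auto simp: tendsto_iff dist_norm)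
  moreover have "eventually (\<lambda>k. y k > K) sequentially"
    using ytop by (simp add: filterlim_at_top_dense)
  ultimately have "eventually (\<lambda>k. cmod (1 + R (\<i> * of_real (y k)) * inverse (- c)) < e \<and> y k > K) sequentially"
    by eventually_elim simp
  then obtain k where k: "cmod (1 + R (\<i> * of_real (y k)) * inverse (- c)) < e" "y k > K"
    using eventually_happens'[OF sequentially_bot] by blast
  have "exp (of_real t * (\<i> * of_real (y k))) = cis (Arg (- c) + 2 * pi * real k)"
    using t by (simp add: y_def cis_conv_exp)
  also have "\<dots> = - c"
    using c c0 by (simp add: cis_mult[symmetric] cis_Arg sgn_div_norm cis_multiple_2pi)
  finally have "exp (- (of_real t * (\<i> * of_real (y k)))) = inverse (- c)"
    by (simp add: exp_minus)
  with k show ?thesis by (intro exI[of _ "y k"]) simp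
qed

section \<open>The sensitivity function\<close>

text \<open>Conjugation carries limits at \<open>z\<close> to limits at \<open>cnj z\<close> and
  back. Where no limit exists, both sides are the default value 0.\<close>

lemma remove_sings_cnj:
  assumes "\<And>s. f (cnj s) = cnj (f s)"
  shows "remove_sings f (cnj z) = cnj (remove_sings f z)"
proof -
  have *: "f \<midarrow>cnj x\<rightarrow> cnj c" if "f \<midarrow>x\<rightarrow> c" for x c
  proof -
    have "w \<noteq> cnj x \<longrightarrow> cnj w \<noteq> x" for w by (metis complex_cnj_cnj)
    hence "eventually (\<lambda>w. cnj w \<noteq> x) (at (cnj x))"
      by (simp add: eventually_at_filter)
    hence "filterlim cnj (at x) (at (cnj x))"
      by (intro filterlim_atI) (auto intro!: tendsto_eq_intros)
    from tendsto_cnj[OF filterlim_compose[OF that this]] show ?thesis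
      by (simp add: assms[symmetric])
  qed
  show ?thesis
  proof (cases "\<exists>c. f \<midarrow>z\<rightarrow> c")
    case True
    then obtain c where c: "f \<midarrow>z\<rightarrow> c" by blast
    show ?thesis using remove_sings_eqI[OF c] remove_sings_eqI[OF *[OF c]] by simp
  next
    case False
    moreover have "\<not> (\<exists>c. f \<midarrow>cnj z\<rightarrow> c)" using *[of _ "cnj z"] False by auto
    ultimately show ?thesis by (simp add: remove_sings_def)
  qed
qed

lemma poly_real_cnj: "poly (map_poly of_real p) (cnj s) = cnj (poly (map_poly of_real p) s)"
  by (simp add: poly_cnj map_poly_map_poly o_def)

lemma poly_analytic: "poly p analytic_on A" for p :: "complex poly"
  by (rule analytic_on_subset[OF _ subset_UNIV]) (auto simp: analytic_on_open intro!: holomorphic_intros)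

locale feedback_loop =
  fixes Q P :: "real poly" and t :: real and G g :: "complex \<Rightarrow> complex"
  assumes P_nz: "P \<noteq> 0" and t_nonneg: "t \<ge> 0"
    and G_eq_transfer: "G = transfer_function Q P t"
    and nontrivial: "\<exists>s. 1 + G s \<noteq> 0"
    and g_eq_sensitivity: "g = sensitivity G"
begin

definition num :: "complex poly" where "num = map_poly of_real Q"
definition den :: "complex poly" where "den = map_poly of_real P"
definition ratio :: "complex \<Rightarrow> complex" where "ratio s = poly num s / poly den s"
definition loop :: "complex \<Rightarrow> complex" where "loop s = ratio s * exp (- (of_real t * s))"

lemma G_loop: "G = remove_sings loop"
  unfolding G_eq_transfer transfer_function_def loop_def ratio_def num_def den_def ..

lemma g_remove_sings: "g = remove_sings (\<lambda>s. 1 / (1 + G s))"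
  unfolding g_eq_sensitivity sensitivity_def ..

lemma den_nz: "den \<noteq> 0"
  using P_nz by (simp add: den_def map_poly_eq_0_iff)

lemma G_nicely_meromorphic: "G nicely_meromorphic_on UNIV"
  unfolding G_loop loop_def ratio_def
  by (intro remove_sings_nicely_meromorphic meromorphic_intros analytic_on_imp_meromorphic_on analytic_intros poly_analytic)

lemma G_meromorphic: "G meromorphic_on A"
  using G_nicely_meromorphic unfolding nicely_meromorphic_on_def by (blast intro: meromorphic_on_subset)

lemma loop_analytic: "poly den s \<noteq> 0 \<Longrightarrow> loop analytic_on {s}"
  unfolding loop_def ratio_def by (intro analytic_intros poly_analytic) auto

lemma G_eq_loop: "poly den s \<noteq> 0 \<Longrightarrow> G s = loop s"
  unfolding G_loop by (intro remove_sings_at_analytic loop_analytic)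

lemma G_analytic: "poly den s \<noteq> 0 \<Longrightarrow> G analytic_on {s}"
  unfolding G_loop by (intro remove_sings_analytic_on loop_analytic)

text \<open>Identity principle: a meromorphic function on the plane that is not constantly
  \<open>- 1\<close> avoids this value near every point, the point itself excepted.\<close>

lemma eventually_one_plus_G_nz: "eventually (\<lambda>w. 1 + G w \<noteq> 0) (at z)"
proof -
  have "\<not> (\<forall>x\<in>UNIV. G x = - 1)" using nontrivial by (auto simp: add_eq_0_iff)
  with nicely_meromorphic_imp_constant_or_avoid[OF G_nicely_meromorphic, of "-1"]
  have "eventually (\<lambda>x. G x \<noteq> - 1) (cosparse UNIV)" by (auto simp: open_UNIV connected_UNIV)
  hence "eventually (\<lambda>x. G x \<noteq> - 1) (at z)" by (auto simp: eventually_cosparse_open_eq)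
  thus ?thesis by eventually_elim (auto simp: add_eq_0_iff)
qed

lemma inverse_meromorphic: "(\<lambda>s. 1 / (1 + G s)) meromorphic_on A"
  by (intro meromorphic_intros G_meromorphic)

lemma g_nicely_meromorphic: "g nicely_meromorphic_on A"
  unfolding g_remove_sings by (intro remove_sings_nicely_meromorphic inverse_meromorphic)

lemma g_meromorphic: "g meromorphic_on A"
  using g_nicely_meromorphic unfolding nicely_meromorphic_on_def by blast

lemma g_analytic: "\<not> is_pole g z \<Longrightarrow> g analytic_on {z}"
  by (rule nicely_meromorphic_on_imp_analytic_at[OF g_nicely_meromorphic, of z UNIV]) auto

lemma g_eq:
  assumes "G analytic_on {z}" "1 + G z \<noteq> 0"
  shows "g z = 1 / (1 + G z)"
  unfolding g_remove_sings using assms by (intro remove_sings_at_analytic analytic_intros) auto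

text \<open>Near \<open>z\<close> the denominator tends to 0 without vanishing. This turns roots of
  the characteristic equation into poles of \<open>g\<close>.\<close>

lemma is_pole_gI:
  assumes "G analytic_on {z}" "1 + G z = 0"
  shows "is_pole g z"
proof -
  have "isCont G z" using assms(1) by (rule analytic_at_imp_isCont)
  hence "((\<lambda>s. 1 + G s) \<longlongrightarrow> 1 + G z) (at z)"
    by (intro tendsto_intros) (simp add: isCont_def)
  hence "filterlim (\<lambda>s. 1 + G s) (at 0) (at z)"
    using assms(2) eventually_one_plus_G_nz by (auto simp: filterlim_at)
  hence "is_pole (\<lambda>s. 1 / (1 + G s)) z" by (intro is_pole_divide) auto
  thus ?thesis unfolding g_remove_sings
    using inverse_meromorphic[of "{z}"] by (simp add: meromorphic_at_iff)
qed

text \<open>Near \<open>z\<close>, apart from \<open>z\<close> itself, \<open>G\<close> is analytic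
  and \<open>1 + G\<close> is nonzero, so \<open>g\<close> is an honest reciprocal there. The
  additivity of \<open>zorder\<close> and the recognition of isolated zeros rely on this.\<close>

lemma eventually_g_nz: "eventually (\<lambda>w. g w \<noteq> 0) (at z)"
proof -
  have "eventually (\<lambda>w. G analytic_on {w}) (cosparse UNIV)"
    by (rule meromorphic_on_imp_analytic_cosparse[OF G_meromorphic])
  hence "eventually (\<lambda>w. G analytic_on {w}) (at z)"
    by (auto simp: eventually_cosparse_open_eq)
  with eventually_one_plus_G_nz show ?thesis
    by eventually_elim (simp add: g_eq)
qed

text \<open>The coefficients and the delay are real. The symmetry carries bounds at nonnegative
  frequencies over to negative ones.\<close>

lemma g_cnj: "g (cnj z) = cnj (g z)"
proof -
  have "loop (cnj s) = cnj (loop s)" for s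
    by (simp add: loop_def ratio_def num_def den_def poly_real_cnj exp_cnj)
  hence "G (cnj s) = cnj (G s)" for s unfolding G_loop by (rule remove_sings_cnj)
  thus ?thesis unfolding g_remove_sings by (intro remove_sings_cnj) simp
qed

text \<open>An isolated zero is a limit condition that excludes a pole, so \<open>G\<close> is
  analytic at \<open>z\<close> with value 0. This reduces (b) to (a).\<close>

lemma g_eq_1_at_zero:
  assumes "isolated_zero G z"
  shows "\<not> is_pole g z" "g z = 1"
proof -
  have "\<not> is_pole G z" using assms pole_is_not_zero by blast
  hence an: "G analytic_on {z}"
    by (intro nicely_meromorphic_on_imp_analytic_at[OF G_nicely_meromorphic]) auto
  hence "G z = 0" using assms zero_isolated_zero_analytic by blast
  thus "g z = 1" using g_eq[OF an] by simp
  have "(\<lambda>s. 1 / (1 + G s)) \<midarrow>z\<rightarrow> 1 / (1 + 0)"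
    using assms by (intro tendsto_intros) (auto simp: isolated_zero_def)
  moreover have "isolated_singularity_at (\<lambda>s. 1 / (1 + G s)) z"
    using inverse_meromorphic[of "{z}"] by (simp add: meromorphic_at_iff)
  ultimately show "\<not> is_pole g z"
    unfolding g_remove_sings by (metis analytic_at_imp_no_pole remove_sings_analytic_at)
qed

section \<open>Boundedness of the sensitivity function near infinity\<close>

lemma bounded_at_infinity_if_loop_bounded_below:
  assumes "eventually (\<lambda>s. Re s \<ge> 0 \<longrightarrow> cmod (1 + loop s) \<ge> d) at_infinity" and "d > 0"
  shows "eventually (\<lambda>s. Re s \<ge> 0 \<longrightarrow> cmod (g s) \<le> 1 / d) at_infinity"
  using assms(1) eventually_poly_nonzero_at_infinity[OF den_nz]
proof eventually_elim
  case (elim s)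
  show ?case
  proof
    assume "Re s \<ge> 0"
    hence *: "cmod (1 + loop s) \<ge> d" using elim by simp
    hence "1 + loop s \<noteq> 0" using \<open>d > 0\<close> by (metis norm_zero not_le)
    hence "g s = 1 / (1 + loop s)"
      using g_eq[OF G_analytic[OF elim(2)]] by (simp add: G_eq_loop elim(2))
    thus "cmod (g s) \<le> 1 / d" using * \<open>d > 0\<close> by (simp add: norm_divide frac_le)
  qed
qed

text \<open>It suffices to keep \<open>|1 + loop|\<close> away from 0. Without delay this is a
  rational function, which can fail only by tending to 0 at infinity, and the bound on the axis
  forbids that. With delay, \<open>fin\<close> and the bound on the axis force the limit of
  \<open>ratio\<close> to have modulus below 1.\<close>

lemma g_bounded_at_infinity:
  assumes fin: "finite {s. Re s > 0 \<and> is_pole g s}"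
    and axis_pole: "\<And>y. y > y0 \<Longrightarrow> \<not> is_pole g (\<i> * of_real y)"
    and axis: "\<And>y. y > y0 \<Longrightarrow> cmod (g (\<i> * of_real y)) \<le> B"
  shows "\<exists>B'. eventually (\<lambda>s. Re s \<ge> 0 \<longrightarrow> cmod (g s) \<le> B') at_infinity"
proof -
  obtain K where K: "\<And>s. cmod s \<ge> K \<Longrightarrow> poly den s \<noteq> 0"
    using eventually_poly_nonzero_at_infinity[OF den_nz] by (auto simp: eventually_at_infinity)
  \<comment> \<open>The maximum with 1 guarantees that \<open>1 / B1\<close> is a positive lower
    bound.\<close>
  define B1 where "B1 = max B 1"
  have axis_below: "cmod (1 + loop (\<i> * of_real y)) \<ge> 1 / B1" if "y > y0" "y \<ge> K" "y \<ge> 0" for y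
  proof -
    have den: "poly den (\<i> * of_real y) \<noteq> 0" using that by (intro K) (simp add: norm_mult)
    have nz: "1 + G (\<i> * of_real y) \<noteq> 0"
      using is_pole_gI[OF G_analytic[OF den]] axis_pole[OF that(1)] by blast
    have "1 / cmod (1 + loop (\<i> * of_real y)) \<le> B1"
      using axis[OF that(1)] g_eq[OF G_analytic[OF den] nz] by (simp add: G_eq_loop den norm_divide B1_def)
    thus ?thesis using nz by (simp add: G_eq_loop den B1_def field_simps)
  qed
  have imag_inf: "filterlim (\<lambda>y. \<i> * complex_of_real y) at_infinity at_top"
    by (intro tendsto_mult_filterlim_at_infinity[OF tendsto_const] filterlim_compose[OF filterlim_of_real_at_infinity]
           filterlim_at_top_imp_at_infinity filterlim_ident) auto
  show ?thesis
  proof (cases "t = 0")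
    case True
    have eq: "1 + loop s = poly (den + num) s / poly den s" if "poly den s \<noteq> 0" for s
      unfolding loop_def ratio_def using that True by (simp add: field_simps)
    have ev_eq: "eventually (\<lambda>s. poly (den + num) s / poly den s = 1 + loop s) at_infinity"
      using eventually_poly_nonzero_at_infinity[OF den_nz] by eventually_elim (rule eq[symmetric])
    show ?thesis
    proof (cases "degree (den + num) < degree den")
      case True
      have "((\<lambda>s. 1 + loop s) \<longlongrightarrow> 0) at_infinity"
        by (rule Lim_transform_eventually[OF poly_quotient_tendsto_0[OF True] ev_eq])
      hence "((\<lambda>y. 1 + loop (\<i> * of_real y)) \<longlongrightarrow> 0) at_top" by (rule filterlim_compose[OF _ imag_inf])
      moreover have "1 / B1 > 0" by (simp add: B1_def)
      ultimately have "eventually (\<lambda>y. cmod (1 + loop (\<i> * of_real y)) < 1 / B1) at_top"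
        by (simp only: tendsto_iff dist_norm diff_0_right)
      hence "eventually (\<lambda>y. cmod (1 + loop (\<i> * of_real y)) < 1 / B1 \<and> y > y0 \<and> y \<ge> K \<and> y \<ge> 0) at_top"
        using eventually_gt_at_top[of y0] eventually_ge_at_top[of K] eventually_ge_at_top[of 0]
        by eventually_elim simp
      then obtain y where "cmod (1 + loop (\<i> * of_real y)) < 1 / B1" "y > y0" "y \<ge> K" "y \<ge> 0"
        using eventually_happens'[OF trivial_limit_at_top_linorder] by blast
      thus ?thesis using axis_below[of y] by linarith
    next
      case False
      define m where "m = degree (den + num) - degree den"
      define c where "c = lead_coeff (den + num) / lead_coeff den"
      \<comment> \<open>Otherwise \<open>1 + G\<close> would vanish off the finitely many zeros of
        \<open>den\<close>, against \<open>eventually_one_plus_G_nz\<close>.\<close>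
      have "den + num \<noteq> 0"
      proof
        assume "den + num = 0"
        hence "1 + loop s = 0" if "poly den s \<noteq> 0" for s using eq[OF that] by simp
        hence "1 + G s = 0" if "poly den s \<noteq> 0" for s using that by (simp add: G_eq_loop)
        moreover have "eventually (\<lambda>s. poly den s \<noteq> 0) (at 0)"
          using islimpt_finite[OF poly_roots_finite[OF den_nz]] by (auto simp: islimpt_iff_eventually)
        ultimately have "eventually (\<lambda>s. 1 + G s = 0) (at 0)" by (auto elim: eventually_mono)
        with eventually_one_plus_G_nz[of 0] have "eventually (\<lambda>s::complex. False) (at 0)"
          by eventually_elim simp
        thus False by simp
      qed
      hence c: "c \<noteq> 0" using den_nz by (simp only: c_def divide_eq_0_iff leading_coeff_0_iff) simp
      have "((\<lambda>s. poly (den + num) s / poly den s / s ^ m) \<longlongrightarrow> c) at_infinity"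
        unfolding m_def c_def using False by (intro poly_quotient_tendsto den_nz) simp
      hence "((\<lambda>s. cmod (poly (den + num) s / poly den s / s ^ m)) \<longlongrightarrow> cmod c) at_infinity"
        by (rule tendsto_norm)
      moreover have "cmod c / 2 < cmod c" using c by simp
      ultimately have "eventually (\<lambda>s. cmod (poly (den + num) s / poly den s / s ^ m) > cmod c / 2) at_infinity"
        by (rule order_tendstoD)
      \<comment> \<open>For \<open>|s| \<ge> 1\<close> dividing by \<open>s ^ m\<close> does not
        increase the modulus, so the lower bound passes to \<open>1 + loop\<close> itself.\<close>
      moreover have "eventually (\<lambda>s::complex. cmod s \<ge> 1) at_infinity"
        by (auto simp: eventually_at_infinity)
      ultimately have "eventually (\<lambda>s. Re s \<ge> 0 \<longrightarrow> cmod (1 + loop s) \<ge> cmod c / 2) at_infinity"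
        using ev_eq
      proof eventually_elim
        case (elim s)
        have "cmod c / 2 < cmod (1 + loop s) / cmod s ^ m"
          using elim(1) unfolding elim(3) by (simp only: norm_divide norm_power)
        also have "\<dots> \<le> cmod (1 + loop s) / 1"
          using one_le_power[OF elim(2), of m] by (intro divide_left_mono) auto
        finally show ?case by simp
      qed
      thus ?thesis using bounded_at_infinity_if_loop_bounded_below[of "cmod c / 2"] c by auto
    qed
  next
    case False
    hence t: "t > 0" using t_nonneg by simp
    have "\<exists>r. (ratio \<longlongrightarrow> r) at_infinity \<and> cmod r < 1"
    proof (cases "degree num < degree den")
      case True
      thus ?thesis using poly_quotient_tendsto_0[OF True] by (intro exI[of _ 0]) (simp add: ratio_def[abs_def])
    next
      case deg: False
      show ?thesis
      proof (cases "num = 0")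
        case True
        thus ?thesis by (intro exI[of _ 0]) (simp add: ratio_def[abs_def])
      next
        case num: False
        define m where "m = degree num - degree den"
        define c where "c = lead_coeff num / lead_coeff den"
        have c: "c \<noteq> 0" using num den_nz by (simp add: c_def)
        have lim: "((\<lambda>s. ratio s / s ^ m) \<longlongrightarrow> c) at_infinity"
          unfolding m_def c_def ratio_def using deg by (intro poly_quotient_tendsto den_nz) simp
        \<comment> \<open>In these cases \<open>1 + loop\<close> has a root in the half plane beyond
          any given radius. Taken beyond the zeros of \<open>den\<close> and beyond the finitely
          many poles of \<open>g\<close>, it would be a further pole.\<close>
        have small: "\<not> (m > 0 \<or> cmod c > 1)"
        proof
          assume "m > 0 \<or> cmod c > 1"
          have "\<exists>K. \<forall>s\<in>{s. Re s > 0 \<and> is_pole g s}. cmod s \<le> K"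
            using finite_imp_bounded[OF fin] by (simp add: bounded_iff)
          then obtain K' where K': "\<And>s. Re s > 0 \<Longrightarrow> is_pole g s \<Longrightarrow> cmod s \<le> K'" by blast
          have "isCont ratio s" if "cmod s \<ge> max K K'" for s
            using K[of s] that unfolding ratio_def by (intro continuous_intros) auto
          from delay_equation_zeros[OF lim c t \<open>m > 0 \<or> cmod c > 1\<close> this]
          obtain s where s: "Re s > 0" "cmod s > max K K'" "1 + loop s = 0"
            unfolding loop_def by blast
          have "poly den s \<noteq> 0" using s(2) by (intro K) simp
          hence "is_pole g s" using s(3) by (intro is_pole_gI G_analytic) (simp_all add: G_eq_loop)
          thus False using K'[OF s(1)] s(2) by simp
        qed
        hence lim': "(ratio \<longlongrightarrow> c) at_infinity" using lim by simp
        have "cmod c \<noteq> 1"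
        proof
          assume "cmod c = 1"
          have "1 / B1 > 0" by (simp add: B1_def)
          from delay_equation_near_zeros[OF lim' \<open>cmod c = 1\<close> t this, of "max 0 (max y0 K)"]
          obtain y where "y > max 0 (max y0 K)" "cmod (1 + loop (\<i> * of_real y)) < 1 / B1"
            unfolding loop_def by blast
          thus False using axis_below[of y] by simp
        qed
        thus ?thesis using lim' small by (intro exI[of _ c]) auto
      qed
    qed
    then obtain r where r: "(ratio \<longlongrightarrow> r) at_infinity" "cmod r < 1" by blast
    obtain q where q: "cmod r < q" "q < 1" using dense[OF r(2)] by blast
    have "eventually (\<lambda>s. cmod (ratio s) < q) at_infinity"
      using tendsto_norm[OF r(1)] q(1) by (rule order_tendstoD)
    \<comment> \<open>In the closed right half plane the delay factor has modulus at most 1, so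
      \<open>|loop| \<le> |ratio| < q\<close>.\<close>
    hence "eventually (\<lambda>s. Re s \<ge> 0 \<longrightarrow> cmod (1 + loop s) \<ge> 1 - q) at_infinity"
    proof eventually_elim
      case (elim s)
      show ?case
      proof
        assume "Re s \<ge> 0"
        hence "exp (- (t * Re s)) \<le> 1" using t by simp
        hence "cmod (loop s) \<le> cmod (ratio s) * 1"
          unfolding loop_def norm_mult by (intro mult_left_mono) (auto simp: norm_exp_eq_Re)
        thus "cmod (1 + loop s) \<ge> 1 - q"
          using elim norm_diff_ineq[of 1 "loop s"] by simp
      qed
    qed
    thus ?thesis using bounded_at_infinity_if_loop_bounded_below[of "1 - q"] q by auto
  qed
qed

end

section \<open>Removing zeros and poles\<close>

text \<open>The reciprocal of a finite Blaschke product of the right half plane, so that multiplying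
  by it removes zeros and dividing by it removes poles.\<close>

definition blaschke_recip :: "complex list \<Rightarrow> complex \<Rightarrow> complex" where
  "blaschke_recip as s = (\<Prod>a\<leftarrow>as. (s + cnj a) / (s - a))"

lemma blaschke_recip_simps [simp]:
  "blaschke_recip [] s = 1"
  "blaschke_recip (a # as) s = (s + cnj a) / (s - a) * blaschke_recip as s"
  by (simp_all add: blaschke_recip_def)

lemma blaschke_recip_meromorphic: "blaschke_recip as meromorphic_on A"
  unfolding blaschke_recip_def[abs_def]
  by (induction as) (auto intro!: meromorphic_intros)

lemma blaschke_recip_analytic: "z \<notin> set as \<Longrightarrow> blaschke_recip as analytic_on {z}"
  unfolding blaschke_recip_def[abs_def]
  by (induction as) (auto intro!: analytic_intros)

lemma add_cnj_nz: "Re a > 0 \<Longrightarrow> Re z \<ge> 0 \<Longrightarrow> z + cnj a \<noteq> 0"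
  by (auto simp: complex_eq_iff)

lemma blaschke_recip_nz:
  assumes "\<And>a. a \<in> set as \<Longrightarrow> Re a > 0" "Re z \<ge> 0" "z \<notin> set as"
  shows "blaschke_recip as z \<noteq> 0"
  using assms by (induction as) (auto simp: add_cnj_nz)

lemma eventually_blaschke_recip_nz: "eventually (\<lambda>w. blaschke_recip as w \<noteq> 0) (at z)"
proof -
  have "eventually (\<lambda>w. w \<notin> set as \<union> (\<lambda>a. - cnj a) ` set as) (at z)"
    using islimpt_finite[of "set as \<union> (\<lambda>a. - cnj a) ` set as" z] by (simp add: islimpt_iff_eventually)
  thus ?thesis
    by eventually_elim (induction as, auto simp: add_eq_0_iff2)
qed

text \<open>\<open>- cnj a\<close> is the mirror image of \<open>a\<close> in the imaginary axis, so
  points of the axis are equidistant from both.\<close>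

lemma norm_blaschke_recip_imaginary:
  assumes "\<And>a. a \<in> set as \<Longrightarrow> Re a > 0"
  shows "cmod (blaschke_recip as (\<i> * of_real y)) = 1"
  using assms
proof (induction as)
  case (Cons a as)
  have "cmod (\<i> * of_real y + cnj a) = cmod (\<i> * of_real y - a)"
    by (simp add: cmod_def power2_eq_square algebra_simps)
  moreover have "\<i> * of_real y - a \<noteq> 0" using Cons.prems[of a] by (auto simp: complex_eq_iff)
  ultimately show ?case using Cons by (simp add: norm_mult norm_divide)
qed simp

lemma blaschke_recip_tendsto_1: "(blaschke_recip as \<longlongrightarrow> 1) at_infinity"
proof (induction as)
  case (Cons a as)
  have "((\<lambda>s. (1 + cnj a * inverse s) / (1 - a * inverse s)) \<longlongrightarrow> (1 + cnj a * 0) / (1 - a * 0)) at_infinity"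
    by (intro tendsto_intros tendsto_inverse_0) auto
  moreover have "eventually (\<lambda>s. (1 + cnj a * inverse s) / (1 - a * inverse s) = (s + cnj a) / (s - a)) at_infinity"
    using eventually_not_equal_at_infinity[of "0::complex"]
  proof eventually_elim
    case (elim s)
    have "1 + cnj a * inverse s = (s + cnj a) / s" "1 - a * inverse s = (s - a) / s"
      using elim by (simp_all add: field_simps)
    thus ?case using elim by simp
  qed
  ultimately have "((\<lambda>s. (s + cnj a) / (s - a)) \<longlongrightarrow> 1) at_infinity"
    by (simp add: Lim_transform_eventually)
  from tendsto_mult[OF this Cons] show ?case by (simp add: blaschke_recip_def)
qed simp

text \<open>Each factor has a simple pole at its \<open>a\<close>, while its zero
  \<open>- cnj a\<close> lies in the left half plane; orders add over the product.\<close>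

lemma zorder_blaschke_recip:
  assumes "\<And>a. a \<in> set as \<Longrightarrow> Re a > 0" "Re z > 0"
  shows "zorder (blaschke_recip as) z = - int (count_list as z)"
  using assms(1)
proof (induction as)
  case Nil
  have "zorder (\<lambda>_. 1 :: complex) z = 0"
    by (rule zorder_eqI[of UNIV z "\<lambda>_. 1"]) auto
  thus ?case by (simp add: blaschke_recip_def)
next
  case (Cons a as)
  define q where "q = (\<lambda>s. (s + cnj a) / (s - a))"
  have q: "zorder q z = (if a = z then - 1 else 0)"
  proof (cases "a = z")
    case True
    have "zorder q z = - 1"
      using assms(2) True by (intro zorder_eqI[of UNIV z "\<lambda>s. s + cnj a"])
        (auto simp: q_def power_int_minus divide_inverse complex_eq_iff intro!: holomorphic_intros)
    thus ?thesis using True by simp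
  next
    case False
    have "zorder q z = 0"
      using assms(2) Cons.prems[of a] False by (intro zorder_eqI[of "- {a}" z q])
        (auto simp: q_def add_cnj_nz intro!: holomorphic_intros)
    thus ?thesis using False by simp
  qed
  have "zorder (\<lambda>s. q s * blaschke_recip as s) z = zorder q z + zorder (blaschke_recip as) z"
  proof (rule zorder_mult)
    show "q meromorphic_on {z}" unfolding q_def by (intro meromorphic_intros)
    show "\<exists>\<^sub>F w in at z. q w \<noteq> 0" "\<exists>\<^sub>F w in at z. blaschke_recip as w \<noteq> 0"
      using eventually_blaschke_recip_nz[of "[a]" z] eventually_blaschke_recip_nz[of as z]
      by (auto simp: q_def intro!: eventually_frequently elim!: eventually_mono)
  qed (rule blaschke_recip_meromorphic)
  thus ?case using Cons q by (simp add: q_def blaschke_recip_def)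
qed

lemma ln_norm_blaschke_recip:
  assumes "\<And>a. a \<in> set as \<Longrightarrow> Re a > 0" "\<sigma> > 0" "of_real \<sigma> \<notin> set as"
  shows "ln (cmod (blaschke_recip as (of_real \<sigma>)))
       = (\<Sum>a\<leftarrow>as. ln (cmod ((of_real \<sigma> + cnj a) / (of_real \<sigma> - a))))"
  using assms
proof (induction as)
  case (Cons a as)
  have "(of_real \<sigma> + cnj a) / (of_real \<sigma> - a) \<noteq> 0"
    using blaschke_recip_nz[of "[a]" "of_real \<sigma>"] Cons.prems by auto
  moreover have "blaschke_recip as (of_real \<sigma>) \<noteq> 0"
    using Cons.prems by (intro blaschke_recip_nz) auto
  ultimately have "ln (cmod (blaschke_recip (a # as) (of_real \<sigma>)))
      = ln (cmod ((of_real \<sigma> + cnj a) / (of_real \<sigma> - a))) + ln (cmod (blaschke_recip as (of_real \<sigma>)))"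
    by (simp only: blaschke_recip_simps norm_mult) (simp add: ln_mult)
  thus ?case using Cons by simp
qed simp

text \<open>The fractions over \<open>\<alpha>\<close> are inverse to the factors of
  \<open>blaschke_recip\<close>, which accounts for the minus sign. Thus \<open>log_blaschke\<close>
  is exactly what is lost in \<open>ln |g|\<close> when zeros and poles are divided out.\<close>

lemma log_blaschke_eq:
  assumes "\<And>a. a \<in> set \<alpha> \<Longrightarrow> Re a > 0" "\<And>b. b \<in> set \<beta> \<Longrightarrow> Re b > 0" "\<sigma> > 0"
    "of_real \<sigma> \<notin> set \<alpha>" "of_real \<sigma> \<notin> set \<beta>"
  shows "log_blaschke \<alpha> \<beta> \<sigma>
       = ln (cmod (blaschke_recip \<beta> (of_real \<sigma>))) - ln (cmod (blaschke_recip \<alpha> (of_real \<sigma>)))"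
proof -
  have "ln (cmod ((of_real \<sigma> - a) / (of_real \<sigma> + cnj a))) = - ln (cmod ((of_real \<sigma> + cnj a) / (of_real \<sigma> - a)))"
    for a by (simp add: norm_divide flip: ln_inverse)
  hence "(\<Sum>a\<leftarrow>\<alpha>. ln (cmod ((of_real \<sigma> - a) / (of_real \<sigma> + cnj a))))
      = - (\<Sum>a\<leftarrow>\<alpha>. ln (cmod ((of_real \<sigma> + cnj a) / (of_real \<sigma> - a))))"
    by (simp add: uminus_sum_list_map o_def)
  thus ?thesis using assms by (simp add: log_blaschke_def ln_norm_blaschke_recip)
qed

section \<open>The logarithmic estimate for the sensitivity function\<close>

context feedback_loop begin

lemma norm_g_abs: "cmod (g (\<i> * of_real y)) = cmod (g (\<i> * of_real \<bar>y\<bar>))"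
proof (cases "y \<ge> 0")
  case False
  hence "\<i> * of_real \<bar>y\<bar> = cnj (\<i> * of_real y)" by simp
  thus ?thesis by (simp only: g_cnj complex_mod_cnj)
qed simp

text \<open>The left side is \<open>ln |f(\<sigma>)|\<close>, where \<open>f\<close> is
  \<open>g\<close> with its zeros and poles in the half plane divided out, and the right side is the
  bound of the two constants theorem.\<close>

lemma log_sensitivity_le:
  assumes \<alpha>: "lists_zeros g open_RHP \<alpha>" and \<beta>: "lists_poles g open_RHP \<beta>"
    and w: "w > 0"
    and inner: "\<And>y. 0 \<le> y \<Longrightarrow> y \<le> w \<Longrightarrow> cmod (g (\<i> * of_real y)) \<le> exp b1"
    and outer: "\<And>y. w < y \<Longrightarrow> cmod (g (\<i> * of_real y)) \<le> exp b2"
    and \<sigma>: "\<sigma> > 0" "\<not> isolated_zero g (of_real \<sigma>)" "\<not> is_pole g (of_real \<sigma>)"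
  shows "ln (cmod (g (of_real \<sigma>))) - log_blaschke \<alpha> \<beta> \<sigma>
       \<le> b2 + (b1 - b2) * (2 / pi * arctan (w / \<sigma>))"
proof -
  have count_\<alpha>: "count_list \<alpha> z = (if Re z > 0 \<and> isolated_zero g z then nat (zorder g z) else 0)" for z
    using \<alpha> by (simp add: lists_zeros_def open_RHP_def)
  have count_\<beta>: "count_list \<beta> z = (if Re z > 0 \<and> is_pole g z then nat (- zorder g z) else 0)" for z
    using \<beta> by (simp add: lists_poles_def open_RHP_def)
  have set_\<alpha>: "Re a > 0 \<and> isolated_zero g a" if "a \<in> set \<alpha>" for a
    using that count_\<alpha>[of a] by (metis count_list_0_iff)
  have set_\<beta>: "Re b > 0 \<and> is_pole g b" if "b \<in> set \<beta>" for b
    using that count_\<beta>[of b] by (metis count_list_0_iff)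
  have iso: "isolated_singularity_at g z" "not_essential g z" for z
    using g_meromorphic[of "{z}"] by (simp_all add: meromorphic_at_iff)
  have pole_in_\<beta>: "z \<in> set \<beta>" if "Re z > 0" "is_pole g z" for z
    using that count_\<beta>[of z] isolated_pole_imp_neg_zorder[OF iso(1) that(2)]
    by (metis (no_types, lifting) count_list_0_iff neg_0_less_iff_less not_less_iff_gr_or_eq zero_less_nat_eq)
  have axis_bound: "cmod (g (\<i> * of_real y)) \<le> max (exp b1) (exp b2)" for y
  proof -
    have "cmod (g (\<i> * of_real y)) = cmod (g (\<i> * of_real \<bar>y\<bar>))" by (rule norm_g_abs)
    also have "\<dots> \<le> max (exp b1) (exp b2)"
      using inner[of "\<bar>y\<bar>"] outer[of "\<bar>y\<bar>"] by (cases "\<bar>y\<bar> \<le> w") auto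
    finally show ?thesis .
  qed
  \<comment> \<open>Near a pole \<open>|g|\<close> would exceed every bound along the axis as well,
    whereas \<open>axis_bound\<close> holds at every point of the axis.\<close>
  have axis_pole: "\<not> is_pole g (\<i> * of_real y)" for y
  proof
    assume "is_pole g (\<i> * of_real y)"
    moreover have "filterlim (\<lambda>x. \<i> * complex_of_real x) (at (\<i> * of_real y)) (at y)"
      by (intro filterlim_atI tendsto_intros) (auto simp: eventually_at_filter)
    ultimately have "filterlim (\<lambda>x. g (\<i> * of_real x)) at_infinity (at y)"
      unfolding is_pole_def by (rule filterlim_compose)
    hence "filterlim (\<lambda>x. cmod (g (\<i> * of_real x))) at_top (at y)"
      by (rule filterlim_at_infinity_imp_norm_at_top)
    hence "eventually (\<lambda>x. cmod (g (\<i> * of_real x)) > max (exp b1) (exp b2)) (at y)"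
      by (simp only: filterlim_at_top_dense)
    then obtain x where "cmod (g (\<i> * of_real x)) > max (exp b1) (exp b2)"
      using eventually_happens'[OF trivial_limit_at] by blast
    thus False using axis_bound[of x] by linarith
  qed
  define h where "h = (\<lambda>s. g s * blaschke_recip \<alpha> s / blaschke_recip \<beta> s)"
  define f where "f = remove_sings h"
  have h_mero: "h meromorphic_on A" for A
    unfolding h_def by (intro meromorphic_intros g_meromorphic blaschke_recip_meromorphic)
  have f_nice: "f nicely_meromorphic_on UNIV"
    unfolding f_def by (intro remove_sings_nicely_meromorphic h_mero)
  have h_analytic: "h analytic_on {s}" if "Re s \<ge> 0" "s \<notin> set \<alpha>" "s \<notin> set \<beta>" for s
  proof -
    have "\<not> is_pole g s"
    proof (cases "Re s = 0")
      case True
      hence "s = \<i> * of_real (Im s)" by (simp add: complex_eq_iff)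
      thus ?thesis using axis_pole by metis
    next
      case False
      thus ?thesis using that pole_in_\<beta>[of s] by auto
    qed
    thus ?thesis unfolding h_def
      using that set_\<beta> blaschke_recip_nz[of \<beta> s]
      by (intro analytic_intros g_analytic blaschke_recip_analytic) auto
  qed
  have f_eq: "f s = h s" if "Re s \<ge> 0" "s \<notin> set \<alpha>" "s \<notin> set \<beta>" for s
    unfolding f_def by (intro remove_sings_at_analytic h_analytic that)
  have f_analytic: "f analytic_on {s}" if "Re s \<ge> 0" for s
  proof (cases "Re s = 0")
    case True
    hence "h analytic_on {s}" using that set_\<alpha> set_\<beta> by (intro h_analytic) fastforce+
    thus ?thesis unfolding f_def by (rule remove_sings_analytic_on)
  next
    case False
    hence s: "Re s > 0" using that by simp
    \<comment> \<open>Multiplicities are compared: the counts in \<open>\<alpha>\<close> and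
      \<open>\<beta>\<close> compensate the order of \<open>g\<close> at \<open>s\<close>, so
      \<open>h\<close> has no pole there.\<close>
    have "zorder h s = zorder (\<lambda>s. g s * blaschke_recip \<alpha> s) s - zorder (blaschke_recip \<beta>) s"
      unfolding h_def
    proof (rule zorder_divide)
      show "(\<lambda>s. g s * blaschke_recip \<alpha> s) meromorphic_on {s}"
        by (intro meromorphic_intros g_meromorphic blaschke_recip_meromorphic)
      have "eventually (\<lambda>s. g s * blaschke_recip \<alpha> s \<noteq> 0) (at s)"
        using eventually_g_nz eventually_blaschke_recip_nz by eventually_elim simp
      thus "\<exists>\<^sub>F s in at s. g s * blaschke_recip \<alpha> s \<noteq> 0" by (intro eventually_frequently) auto
    qed (auto intro!: blaschke_recip_meromorphic eventually_frequently eventually_blaschke_recip_nz)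
    also have "zorder (\<lambda>s. g s * blaschke_recip \<alpha> s) s = zorder g s + zorder (blaschke_recip \<alpha>) s"
      by (intro zorder_mult g_meromorphic blaschke_recip_meromorphic)
         (auto intro!: eventually_frequently eventually_blaschke_recip_nz eventually_g_nz)
    also have "zorder (blaschke_recip \<alpha>) s = - int (count_list \<alpha> s)"
      using set_\<alpha> s by (intro zorder_blaschke_recip) auto
    also have "zorder (blaschke_recip \<beta>) s = - int (count_list \<beta> s)"
      using set_\<beta> s by (intro zorder_blaschke_recip) auto
    also have "zorder g s + - int (count_list \<alpha> s) - - int (count_list \<beta> s) \<ge> 0"
    proof (cases "is_pole g s")
      case True
      hence "\<not> isolated_zero g s" using pole_is_not_zero by blast
      thus ?thesis using True s by (simp add: count_\<alpha> count_\<beta>)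
    next
      case np: False
      show ?thesis
      proof (cases "isolated_zero g s")
        case True
        thus ?thesis using np s zorder_isolated_zero_pos'[OF True iso(1)] by (simp add: count_\<alpha> count_\<beta>)
      next
        case False
        have "zorder g s = 0" using np False g_meromorphic
          by (intro not_pole_not_isolated_zero_imp_zorder_eq_0)
             (auto intro!: eventually_frequently eventually_g_nz)
        thus ?thesis using np False by (simp add: count_\<alpha> count_\<beta>)
      qed
    qed
    finally have "zorder h s \<ge> 0" .
    have iso_h: "isolated_singularity_at h s" using h_mero[of "{s}"] by (simp add: meromorphic_at_iff)
    hence "\<not> is_pole h s" using isolated_pole_imp_neg_zorder[OF iso_h] \<open>zorder h s \<ge> 0\<close> by auto
    hence "\<not> is_pole f s" unfolding f_def using iso_h by simp
    thus ?thesis by (intro nicely_meromorphic_on_imp_analytic_at[OF f_nice]) auto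
  qed
  have f_cont: "continuous_on {s. Re s \<ge> 0} f"
    using f_analytic by (intro continuous_at_imp_continuous_on) (auto intro: analytic_at_imp_isCont)
  have f_hol: "f holomorphic_on {s. Re s > 0}"
    using f_analytic by (intro analytic_imp_holomorphic) (subst analytic_on_analytic_at, auto)
  have f_axis: "cmod (f (\<i> * of_real y)) = cmod (g (\<i> * of_real y))" for y
  proof -
    have "f (\<i> * of_real y) = h (\<i> * of_real y)"
      using set_\<alpha> set_\<beta> by (intro f_eq) fastforce+
    thus ?thesis using set_\<alpha> set_\<beta> by (simp add: h_def norm_mult norm_divide norm_blaschke_recip_imaginary)
  qed
  \<comment> \<open>Near infinity \<open>g\<close> is bounded and the Blaschke factors tend to 1;
    the remaining half disc is compact and \<open>f\<close> is continuous on it.\<close>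
  have "\<exists>M. \<forall>s. Re s \<ge> 0 \<longrightarrow> cmod (f s) \<le> M"
  proof -
    have "{s. Re s > 0 \<and> is_pole g s} \<subseteq> set \<beta>" using pole_in_\<beta> by auto
    hence "finite {s. Re s > 0 \<and> is_pole g s}" by (rule finite_subset) simp
    from g_bounded_at_infinity[OF this axis_pole axis_bound]
    obtain B where B: "eventually (\<lambda>s. Re s \<ge> 0 \<longrightarrow> cmod (g s) \<le> B) at_infinity" by blast
    have "((\<lambda>s. cmod (blaschke_recip \<alpha> s / blaschke_recip \<beta> s)) \<longlongrightarrow> cmod (1 / 1)) at_infinity"
      by (intro tendsto_intros blaschke_recip_tendsto_1) auto
    hence "eventually (\<lambda>s. cmod (blaschke_recip \<alpha> s / blaschke_recip \<beta> s) < 2) at_infinity"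
      by (rule order_tendstoD) simp
    moreover have "eventually (\<lambda>s. s \<notin> set \<alpha> \<union> set \<beta>) at_infinity"
    proof -
      have "bounded (set \<alpha> \<union> set \<beta>)" by (intro finite_imp_bounded) simp
      then obtain K where "\<And>s. s \<in> set \<alpha> \<union> set \<beta> \<Longrightarrow> cmod s \<le> K" by (auto simp: bounded_iff)
      thus ?thesis unfolding eventually_at_infinity by (intro exI[of _ "K + 1"]) fastforce
    qed
    ultimately have "eventually (\<lambda>s. Re s \<ge> 0 \<longrightarrow> cmod (f s) \<le> B * 2) at_infinity"
      using B
    proof eventually_elim
      case (elim s)
      show ?case
      proof
        assume s: "Re s \<ge> 0"
        have "cmod (g s) * cmod (blaschke_recip \<alpha> s / blaschke_recip \<beta> s) \<le> B * 2"
          using elim s by (intro mult_mono) (auto intro: order_trans[OF norm_ge_zero])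
        thus "cmod (f s) \<le> B * 2" using elim(2) s by (simp add: f_eq h_def norm_mult norm_divide)
      qed
    qed
    then obtain K where K: "\<And>s. cmod s \<ge> K \<Longrightarrow> Re s \<ge> 0 \<Longrightarrow> cmod (f s) \<le> B * 2"
      by (auto simp: eventually_at_infinity)
    have "compact ({s. Re s \<ge> 0} \<inter> cball 0 K)"
      by (intro closed_Int_compact closed_halfspace_Re_ge compact_cball)
    moreover have "continuous_on ({s. Re s \<ge> 0} \<inter> cball 0 K) f"
      by (rule continuous_on_subset[OF f_cont]) auto
    ultimately have "bounded (f ` ({s. Re s \<ge> 0} \<inter> cball 0 K))"
      by (intro compact_imp_bounded compact_continuous_image)
    then obtain M where "\<forall>s\<in>{s. Re s \<ge> 0} \<inter> cball 0 K. cmod (f s) \<le> M"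
      unfolding bounded_iff by blast
    hence "\<And>s. Re s \<ge> 0 \<Longrightarrow> cmod s \<le> K \<Longrightarrow> cmod (f s) \<le> M" by simp
    hence "cmod (f s) \<le> max M (B * 2)" if "Re s \<ge> 0" for s
      using K[of s] that by (cases "cmod s \<le> K") (auto simp: le_max_iff_disj)
    thus ?thesis by blast
  qed
  then obtain M where M: "\<And>s. Re s \<ge> 0 \<Longrightarrow> cmod (f s) \<le> M" by blast
  have *: "cmod (f (of_real \<sigma>)) \<le> exp (b2 + (b1 - b2) * (2 / pi * arctan (w / \<sigma>)))"
  proof (rule half_plane_two_constants[OF f_hol f_cont M w _ _ \<sigma>(1)])
    show "cmod (f (\<i> * of_real y)) \<le> exp b1" if "\<bar>y\<bar> < w" for y
      using that inner[of "\<bar>y\<bar>"] norm_g_abs[of y] by (simp add: f_axis)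
    show "cmod (f (\<i> * of_real y)) \<le> exp b2" if "\<bar>y\<bar> > w" for y
      using that outer[of "\<bar>y\<bar>"] norm_g_abs[of y] by (simp add: f_axis)
  qed
  have not_in: "of_real \<sigma> \<notin> set \<alpha>" "of_real \<sigma> \<notin> set \<beta>" using set_\<alpha> set_\<beta> \<sigma> by blast+
  \<comment> \<open>\<open>g\<close> is analytic at \<open>\<sigma>\<close> and does not vanish
    identically nearby, so a value 0 would be an isolated zero.\<close>
  have g\<sigma>: "g (of_real \<sigma>) \<noteq> 0"
    using \<sigma>(2) eventually_g_nz isolated_zero_analytic_iff[OF g_analytic[OF \<sigma>(3)]] by blast
  have nz: "blaschke_recip \<alpha> (of_real \<sigma>) \<noteq> 0" "blaschke_recip \<beta> (of_real \<sigma>) \<noteq> 0"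
    using set_\<alpha> set_\<beta> not_in \<sigma>(1)
      blaschke_recip_nz[of \<alpha> "of_real \<sigma>"] blaschke_recip_nz[of \<beta> "of_real \<sigma>"] by auto
  have "f (of_real \<sigma>) = h (of_real \<sigma>)" using not_in \<sigma>(1) by (intro f_eq) auto
  hence "ln (cmod (f (of_real \<sigma>))) = ln (cmod (g (of_real \<sigma>))) - log_blaschke \<alpha> \<beta> \<sigma>"
    using g\<sigma> nz set_\<alpha> set_\<beta> not_in \<sigma>(1)
    by (simp add: h_def norm_mult norm_divide ln_mult ln_div log_blaschke_eq)
  moreover have "f (of_real \<sigma>) \<noteq> 0"
    using g\<sigma> nz \<open>f (of_real \<sigma>) = h (of_real \<sigma>)\<close> by (simp add: h_def)
  ultimately show ?thesis
    using * by (metis ln_exp ln_le_cancel_iff exp_gt_zero zero_less_norm_iff)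
qed

end

section \<open>The lower bounds for the sensitivity peak\<close>

theorem theorem2:
  fixes G g :: "complex \<Rightarrow> complex"
    and \<alpha> \<beta> :: "complex list"
    and \<omega>\<^sub>c \<rho> s_max :: real
  assumes "is_transfer_function G"
    and "\<exists>s. 1 + G s \<noteq> 0"
    and "g = sensitivity G"
    and "\<not> g analytic_on open_RHP"
    and "lists_zeros g open_RHP \<alpha>"
    and "lists_poles g open_RHP \<beta>"
    and "\<omega>\<^sub>c > 0"
    and "is_maximum ((\<lambda>\<omega>. cmod (g (\<i> * of_real \<omega>))) ` {0..\<omega>\<^sub>c}) \<rho>"
    and "\<rho> \<in> {0..<1}"
    and "is_finite_supremum ((\<lambda>\<omega>. cmod (g (\<i> * of_real \<omega>))) ` {\<omega>\<^sub>c<..}) s_max"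
    and "s_max > 1"
  shows "(\<forall>\<sigma>::real. \<sigma> > 0 \<and> \<not> isolated_zero g (of_real \<sigma>) \<and> \<not> is_pole g (of_real \<sigma>)
            \<and> - ln (cmod (g (of_real \<sigma>))) + log_blaschke \<alpha> \<beta> \<sigma> < 0 \<longrightarrow>
            ln s_max \<ge>
              \<bar>pi / 2 * (- ln (cmod (g (of_real \<sigma>))) + log_blaschke \<alpha> \<beta> \<sigma>)
                + arctan (\<omega>\<^sub>c / \<sigma>) * ln \<rho>\<bar>
              / (pi / 2 - arctan (\<omega>\<^sub>c / \<sigma>)))
       \<and> (\<forall>\<sigma>::real. \<sigma> > 0 \<and> isolated_zero G (of_real \<sigma>) \<and> log_blaschke \<alpha> \<beta> \<sigma> < 0 \<longrightarrow>
            ln s_max \<ge>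
              \<bar>pi / 2 * log_blaschke \<alpha> \<beta> \<sigma> + arctan (\<omega>\<^sub>c / \<sigma>) * ln \<rho>\<bar>
              / (pi / 2 - arctan (\<omega>\<^sub>c / \<sigma>)))"
proof -
  obtain Q P t where "P \<noteq> 0" "t \<ge> 0" "G = transfer_function Q P t"
    using assms(1) unfolding is_transfer_function_def by blast
  then interpret feedback_loop Q P t G g
    using assms(2,3) by unfold_locales
  \<comment> \<open>For \<open>\<rho> = 0\<close> the convention \<open>ln 0 = 0\<close> turns this into the bound \<open>|g| \<le> 1\<close>.\<close>
  have inner: "cmod (g (\<i> * of_real y)) \<le> exp (ln \<rho>)" if "0 \<le> y" "y \<le> \<omega>\<^sub>c" for y
  proof -
    have "cmod (g (\<i> * of_real y)) \<le> \<rho>" using assms(8) that by (auto simp: is_maximum_def)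
    also have "\<rho> \<le> exp (ln \<rho>)" using assms(9) by (cases "\<rho> = 0") auto
    finally show ?thesis .
  qed
  have outer: "cmod (g (\<i> * of_real y)) \<le> exp (ln s_max)" if "\<omega>\<^sub>c < y" for y
    using assms(10,11) that by (auto simp: is_finite_supremum_def intro!: cSup_upper)
  have a: "ln s_max \<ge> \<bar>pi / 2 * (- ln (cmod (g (of_real \<sigma>))) + log_blaschke \<alpha> \<beta> \<sigma>)
                + arctan (\<omega>\<^sub>c / \<sigma>) * ln \<rho>\<bar> / (pi / 2 - arctan (\<omega>\<^sub>c / \<sigma>))"
    if \<sigma>: "\<sigma> > 0" "\<not> isolated_zero g (of_real \<sigma>)" "\<not> is_pole g (of_real \<sigma>)"
      and neg: "- ln (cmod (g (of_real \<sigma>))) + log_blaschke \<alpha> \<beta> \<sigma> < 0" for \<sigma> :: real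
  proof -
    define X where "X = - ln (cmod (g (of_real \<sigma>))) + log_blaschke \<alpha> \<beta> \<sigma>"
    define A where "A = arctan (\<omega>\<^sub>c / \<sigma>)"
    have A: "A > 0" "A < pi / 2" using assms(7) \<sigma>(1) arctan_ubound by (auto simp: A_def)
    have "ln \<rho> \<le> 0" using assms(9) by (cases "\<rho> = 0") auto
    hence "A * ln \<rho> \<le> 0" using A by (simp add: mult_nonneg_nonpos)
    moreover have "pi / 2 * X \<le> 0" using neg by (simp add: X_def mult_nonneg_nonpos)
    \<comment> \<open>Both summands are nonpositive, so the absolute value is the negated sum. The
      rest solves the estimate, multiplied by \<open>pi / 2\<close>, for
      \<open>ln s_max\<close>.\<close>
    ultimately have abs_eq: "\<bar>pi / 2 * X + A * ln \<rho>\<bar> = pi / 2 * (- X) - A * ln \<rho>" by simp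
    have "- X \<le> ln s_max + (ln \<rho> - ln s_max) * (2 / pi * A)"
      using log_sensitivity_le[OF assms(5,6,7) inner outer \<sigma>] by (simp add: X_def A_def)
    hence "pi / 2 * (- X) \<le> pi / 2 * (ln s_max + (ln \<rho> - ln s_max) * (2 / pi * A))"
      by (intro mult_left_mono) auto
    also have "pi / 2 * (ln s_max + (ln \<rho> - ln s_max) * (2 / pi * A)) = ln s_max * (pi / 2 - A) + A * ln \<rho>"
      by (simp add: field_simps)
    finally have "pi / 2 * (- X) - A * ln \<rho> \<le> ln s_max * (pi / 2 - A)" by simp
    hence "\<bar>pi / 2 * X + A * ln \<rho>\<bar> \<le> ln s_max * (pi / 2 - A)" unfolding abs_eq .
    hence "\<bar>pi / 2 * X + A * ln \<rho>\<bar> / (pi / 2 - A) \<le> ln s_max" using A by (simp add: pos_divide_le_eq)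
    thus ?thesis unfolding X_def A_def .
  qed
  have b: "ln s_max \<ge> \<bar>pi / 2 * log_blaschke \<alpha> \<beta> \<sigma> + arctan (\<omega>\<^sub>c / \<sigma>) * ln \<rho>\<bar>
              / (pi / 2 - arctan (\<omega>\<^sub>c / \<sigma>))"
    if \<sigma>: "\<sigma> > 0" "isolated_zero G (of_real \<sigma>)" and neg: "log_blaschke \<alpha> \<beta> \<sigma> < 0" for \<sigma> :: real
  proof -
    \<comment> \<open>With \<open>g = 1\<close> at \<open>\<sigma>\<close> the term
      \<open>ln |g|\<close> vanishes, and (a) becomes (b).\<close>
    note g1 = g_eq_1_at_zero[OF \<sigma>(2)]
    have "\<not> isolated_zero g (of_real \<sigma>)"
      using zero_isolated_zero_analytic[OF _ g_analytic[OF g1(1)]] g1(2) by auto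
    from a[OF \<sigma>(1) this g1(1)] neg g1(2) show ?thesis by simp
  qed
  show ?thesis using a b by blast
qed

end
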